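(* Let $I$ be a set. For each $i\in I$, let $S_i$ be a near $e_i$ subsemigroup of a semitopological semigroup $T_i$ and let $A_{i}\subseteq S_{i}$. Let us consider the product semitopological semigroup $T=\prod_{i\in I}T_i$ with box topology. Let $S=\prod_{i\in I}S_{i}$, $A=\prod_{i\in I}A_{i}$ and $e=(e_{i})_{i\in I}$. Let $J=\{i\in I:A_i\subseteq S_i \text{ is not thick near } e_i\}$ be a finite set. Then $A\subseteq S$ is central near $e$ if and only if for each $i\in I$, $A_i\subseteq S_i$ is central near $e_i$.
   Context: All semitopological semigroups $(T,+)$ are Hausdorff, with $x\mapsto a+x$ and $x\mapsto x+a$ continuous. For $x\in T$, $\tau_x$ is the set of neighborhoods of $x$. For $e$ an idempotent of $T$ not in a subsemigroup $S$, $S$ is a near $e$ subsemigroup of $T$ if $e\in cl_T(S)$. $\beta S$ is the Stone-Čech compactification of discrete $S$ (ultrafilters on $S$) with its extended operation, and $e_S^*=\{p\in\beta S: U\cap S\in p \text{ for each } U\in\tau_e\}$, a compact subsemigroup of $\beta S$ with smallest ideal $K(e_S^* )$. A set $A\subseteq S$ is central near $e$ if there is an idempotent $p\in K(e_S^* )$ with $A\in p$. $A\subseteq S$ is thick near $e$ if there exists $U\in\tau_e$ such that for each finite nonempty $F\subseteq U\cap S$ and each $V\in\tau_e$ there is $x\in V\cap S$ with $F+x\subseteq A$. The box topology on $\prod_{i\in I}T_i$ is generated by the sets $\prod_{i\in I}U_i$ with each $U_i$ open in $T_i$. *)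

theory Defs
  imports "HOL-Analysis.Analysis"
begin

text \<open>
  Semigroups are given by a carrier set and a binary operation of the ambient type, so that
  families of semigroups indexed by a set can be expressed; only the values of the operation
  on the carrier matter.
\<close>

definition semigroup_on :: "'a set \<Rightarrow> ('a \<Rightarrow> 'a \<Rightarrow> 'a) \<Rightarrow> bool" where
  "semigroup_on M f \<longleftrightarrow>
     (\<forall>x\<in>M. \<forall>y\<in>M. f x y \<in> M) \<and>
     (\<forall>x\<in>M. \<forall>y\<in>M. \<forall>z\<in>M. f (f x y) z = f x (f y z))"

definition semitopological_semigroup :: "'a topology \<Rightarrow> ('a \<Rightarrow> 'a \<Rightarrow> 'a) \<Rightarrow> bool" where
  "semitopological_semigroup X f \<longleftrightarrow>
     Hausdorff_space X \<and> semigroup_on (topspace X) f \<and>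
     (\<forall>a\<in>topspace X. continuous_map X X (\<lambda>x. f a x) \<and> continuous_map X X (\<lambda>x. f x a))"

text \<open>Neighborhoods are not required to be open.\<close>

definition nbhds_of :: "'a topology \<Rightarrow> 'a \<Rightarrow> 'a set set" where
  "nbhds_of X x = {U. U \<subseteq> topspace X \<and> (\<exists>V. openin X V \<and> x \<in> V \<and> V \<subseteq> U)}"

definition near_subsemigroup ::
    "'a topology \<Rightarrow> ('a \<Rightarrow> 'a \<Rightarrow> 'a) \<Rightarrow> 'a \<Rightarrow> 'a set \<Rightarrow> bool" where
  "near_subsemigroup X f e S \<longleftrightarrow>
     e \<in> topspace X \<and> f e e = e \<and>
     S \<subseteq> topspace X \<and> semigroup_on S f \<and>
     e \<notin> S \<and> e \<in> X closure_of S"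

definition ultrafilter_on :: "'a set \<Rightarrow> 'a set set \<Rightarrow> bool" where
  "ultrafilter_on S p \<longleftrightarrow>
     p \<subseteq> Pow S \<and> S \<in> p \<and> {} \<notin> p \<and>
     (\<forall>A\<in>p. \<forall>B\<in>p. A \<inter> B \<in> p) \<and>
     (\<forall>A\<in>p. \<forall>B. A \<subseteq> B \<and> B \<subseteq> S \<longrightarrow> B \<in> p) \<and>
     (\<forall>A. A \<subseteq> S \<longrightarrow> A \<in> p \<or> S - A \<in> p)"

definition beta :: "'a set \<Rightarrow> 'a set set set" where
  "beta S = {p. ultrafilter_on S p}"

text \<open>
  The operation of \<open>S\<close> extended to \<open>beta S\<close>, in the convention for which \<open>p \<mapsto> p + q\<close> is
  continuous for every \<open>q\<close>, and \<open>q \<mapsto> x + q\<close> is continuous for every \<open>x\<close> in \<open>S\<close>: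
  \<open>A \<in> p + q\<close> iff \<open>{x. - x + A \<in> q} \<in> p\<close>, where \<open>- x + A = {y. x + y \<in> A}\<close>.
\<close>

definition beta_op :: "'a set \<Rightarrow> ('a \<Rightarrow> 'a \<Rightarrow> 'a) \<Rightarrow> 'a set set \<Rightarrow> 'a set set \<Rightarrow> 'a set set" where
  "beta_op S f p q = {A. A \<subseteq> S \<and> {x\<in>S. {y\<in>S. f x y \<in> A} \<in> q} \<in> p}"

definition near_star :: "'a topology \<Rightarrow> 'a \<Rightarrow> 'a set \<Rightarrow> 'a set set set" where
  "near_star X e S = {p \<in> beta S. \<forall>U\<in>nbhds_of X e. U \<inter> S \<in> p}"

definition ideal_on :: "'b set \<Rightarrow> ('b \<Rightarrow> 'b \<Rightarrow> 'b) \<Rightarrow> 'b set \<Rightarrow> bool" where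
  "ideal_on M f L \<longleftrightarrow>
     L \<subseteq> M \<and> L \<noteq> {} \<and> (\<forall>x\<in>M. \<forall>y\<in>L. f x y \<in> L \<and> f y x \<in> L)"

text \<open>The intersection of all two-sided ideals is the smallest ideal whenever there is one.\<close>

definition smallest_ideal :: "'b set \<Rightarrow> ('b \<Rightarrow> 'b \<Rightarrow> 'b) \<Rightarrow> 'b set" where
  "smallest_ideal M f = {x\<in>M. \<forall>L. ideal_on M f L \<longrightarrow> x \<in> L}"

definition central_near ::
    "'a topology \<Rightarrow> ('a \<Rightarrow> 'a \<Rightarrow> 'a) \<Rightarrow> 'a \<Rightarrow> 'a set \<Rightarrow> 'a set \<Rightarrow> bool" where
  "central_near X f e S A \<longleftrightarrow>
     (\<exists>p \<in> smallest_ideal (near_star X e S) (beta_op S f). beta_op S f p p = p \<and> A \<in> p)"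

definition thick_near ::
    "'a topology \<Rightarrow> ('a \<Rightarrow> 'a \<Rightarrow> 'a) \<Rightarrow> 'a \<Rightarrow> 'a set \<Rightarrow> 'a set \<Rightarrow> bool" where
  "thick_near X f e S A \<longleftrightarrow>
     (\<exists>U\<in>nbhds_of X e. \<forall>F. finite F \<and> F \<noteq> {} \<and> F \<subseteq> U \<inter> S \<longrightarrow>
        (\<forall>V\<in>nbhds_of X e. \<exists>x \<in> V \<inter> S. (\<lambda>y. f y x) ` F \<subseteq> A))"

definition box_topology :: "'i set \<Rightarrow> ('i \<Rightarrow> 'a topology) \<Rightarrow> ('i \<Rightarrow> 'a) topology" where
  "box_topology I T =
     topology_generated_by {Pi\<^sub>E I U |U. \<forall>i\<in>I. openin (T i) (U i)}"

definition prod_op :: "'i set \<Rightarrow> ('i \<Rightarrow> 'a \<Rightarrow> 'a \<Rightarrow> 'a) \<Rightarrow> ('i \<Rightarrow> 'a) \<Rightarrow> ('i \<Rightarrow> 'a) \<Rightarrow> ('i \<Rightarrow> 'a)" where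
  "prod_op I f x y = (\<lambda>i\<in>I. f i (x i) (y i))"

end

theory Submission
  imports Defs
begin

text \<open>
  The coordinate projections extend to surjective homomorphisms from the semigroup of ultrafilters
  near \<open>e\<close> onto the corresponding semigroups of the factors, and such homomorphisms preserve
  idempotents and smallest ideals; this gives one direction. Conversely, let \<open>p j\<close> be idempotents
  in the smallest ideals of the finitely many factors \<open>J\<close> that are not thick. Thickness of the other
  factors passes to the box product, so some left ideal lies in the closure of
  \<open>{x. \<forall>i\<in>I - J. x i \<in> A i}\<close> and projects into the minimal left ideal of each \<open>p j\<close>.
  A minimal left ideal inside it meets the fibre over \<open>p\<close> in a nonempty compact subsemigroup,
  and Ellis' lemma provides an idempotent there. It contains \<open>Pi\<^sub>E I A\<close> because \<open>J\<close> is finite.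
  Neighborhoods enter only through the filter base of their traces on \<open>S\<close>; for the box topology
  the products of traces form such a base.
\<close>

section \<open>Compact right topological semigroups\<close>

text \<open>A chain of nonempty closed sets has the finite intersection property, so by compactness
  its intersection is nonempty and serves as the lower bound for Zorn's lemma. The premise
  \<open>Inter\<close> leaves nonemptiness to this argument.\<close>

lemma compact_space_minimal_closed:
  assumes "compact_space X" and "\<A> \<noteq> {}"
    and closed: "\<And>D. D \<in> \<A> \<Longrightarrow> closedin X D \<and> D \<noteq> {}"
    and Inter: "\<And>\<C>. \<lbrakk>\<C> \<subseteq> \<A>; \<C> \<noteq> {}; \<Inter>\<C> \<noteq> {}\<rbrakk> \<Longrightarrow> \<Inter>\<C> \<in> \<A>"
  shows "\<exists>D\<in>\<A>. \<forall>E\<in>\<A>. E \<subseteq> D \<longrightarrow> E = D"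
proof -
  \<comment> \<open>Complements reverse inclusion, so a maximal complement yields a minimal
    member.\<close>
  have "\<exists>M\<in>uminus ` \<A>. \<forall>Y\<in>uminus ` \<A>. M \<subseteq> Y \<longrightarrow> Y = M"
  proof (rule subset_Zorn_nonempty)
    show "uminus ` \<A> \<noteq> {}"
      using assms(2) by simp
    fix \<C> assume ne: "\<C> \<noteq> {}" and chain: "subset.chain (uminus ` \<A>) \<C>"
    define \<D> where "\<D> = uminus ` \<C>"
    have sub: "\<D> \<subseteq> \<A>" "\<D> \<noteq> {}"
      using ne chain by (auto simp: \<D>_def subset.chain_def)
    have lin: "D \<subseteq> E \<or> E \<subseteq> D" if "D \<in> \<D>" "E \<in> \<D>" for D E
      using that chain unfolding \<D>_def subset_chain_def by (metis Compl_subset_Compl_iff imageE)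
    \<comment> \<open>In a chain the intersection of finitely many members is one of them, hence
      nonempty.\<close>
    have least: "\<exists>D\<in>\<F>. \<Inter>\<F> = D" if "finite \<F>" "\<F> \<noteq> {}" "\<F> \<subseteq> \<D>" for \<F>
      using that
    proof (induction \<F> rule: finite_ne_induct)
      case (insert E \<F>)
      then obtain D where D: "D \<in> \<F>" "\<Inter>\<F> = D"
        by auto
      then have "\<Inter>(insert E \<F>) = E \<inter> D"
        by simp
      moreover have "E \<inter> D = D \<or> E \<inter> D = E"
        using lin[of D E] D(1) insert.prems by auto
      ultimately show ?case
        using D(1) by auto
    qed auto
    have "\<Inter>\<F> \<noteq> {}" if "finite \<F>" "\<F> \<subseteq> \<D>" for \<F>
    proof (cases "\<F> = {}")
      case False
      then show ?thesis
        using least[OF that(1) False that(2)] that(2) sub(1) closed by blast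
    qed auto
    then have "\<Inter>\<D> \<noteq> {}"
      using assms(1)[unfolded compact_space_fip] closed sub(1)
      by (metis subsetD)
    then have "\<Inter>\<D> \<in> \<A>"
      using Inter sub by blast
    moreover have "\<Union>\<C> = - \<Inter>\<D>"
      by (auto simp: \<D>_def)
    ultimately show "\<Union>\<C> \<in> uminus ` \<A>"
      by blast
  qed
  then obtain M where M: "M \<in> uminus ` \<A>" "\<And>Y. Y \<in> uminus ` \<A> \<Longrightarrow> M \<subseteq> Y \<Longrightarrow> Y = M"
    by meson
  then obtain D where D: "D \<in> \<A>" "M = - D"
    by blast
  have "E = D" if "E \<in> \<A>" "E \<subseteq> D" for E
    using M(2)[of "- E"] that D(2) by simp
  then show ?thesis
    using D(1) by blast
qed

section \<open>Semigroups with continuous right translations and Ellis' lemma\<close>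

lemma semigroup_onD:
  assumes "semigroup_on M f"
  shows "\<And>x y. \<lbrakk>x \<in> M; y \<in> M\<rbrakk> \<Longrightarrow> f x y \<in> M"
    and "\<And>x y z. \<lbrakk>x \<in> M; y \<in> M; z \<in> M\<rbrakk> \<Longrightarrow> f (f x y) z = f x (f y z)"
  using assms by (auto simp: semigroup_on_def)

locale compact_right_topological_semigroup =
  fixes X :: "'b topology" and f :: "'b \<Rightarrow> 'b \<Rightarrow> 'b"
  assumes compact: "compact_space X"
    and Hausdorff: "Hausdorff_space X"
    and semigroup: "semigroup_on (topspace X) f"
    and continuous: "\<And>q. q \<in> topspace X \<Longrightarrow> continuous_map X X (\<lambda>p. f p q)"
begin

lemmas mem = semigroup_onD(1)[OF semigroup]
lemmas assoc = semigroup_onD(2)[OF semigroup]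

lemma closedin_right_translate:
  assumes "closedin X D" "q \<in> topspace X"
  shows "closedin X ((\<lambda>p. f p q) ` D)"
  using assms compact Hausdorff continuous
  by (meson closedin_compact_space compactin_imp_closedin image_compactin)

text \<open>Take a minimal closed subsemigroup \<open>D\<close> of \<open>C\<close> and
  \<open>x\<close> in it. The right translate of \<open>D\<close> by \<open>x\<close> is again such
  a subsemigroup, so it equals \<open>D\<close> and some \<open>y\<close> satisfies
  \<open>f y x = x\<close>. The solutions of this equation in \<open>D\<close> form a closed
  subsemigroup too, so they exhaust \<open>D\<close>, and \<open>x\<close> itself is a
  solution.\<close>

lemma ellis:
  assumes "closedin X C" "C \<noteq> {}" and sub: "\<And>x y. \<lbrakk>x \<in> C; y \<in> C\<rbrakk> \<Longrightarrow> f x y \<in> C"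
  obtains x where "x \<in> C" "f x x = x"
proof -
  define \<A> where
    "\<A> = {D. closedin X D \<and> D \<noteq> {} \<and> D \<subseteq> C \<and> (\<forall>x\<in>D. \<forall>y\<in>D. f x y \<in> D)}"
  have "\<exists>D\<in>\<A>. \<forall>E\<in>\<A>. E \<subseteq> D \<longrightarrow> E = D"
  proof (rule compact_space_minimal_closed[OF compact, of \<A>])
    show "\<A> \<noteq> {}"
      using assms by (auto simp: \<A>_def)
    show "closedin X D \<and> D \<noteq> {}" if "D \<in> \<A>" for D
      using that by (auto simp: \<A>_def)
    show "\<Inter>\<C> \<in> \<A>" if "\<C> \<subseteq> \<A>" "\<C> \<noteq> {}" "\<Inter>\<C> \<noteq> {}" for \<C>
    proof -
      have "closedin X (\<Inter>\<C>)"
        using that by (intro closedin_Inter) (auto simp: \<A>_def)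
      moreover have "\<Inter>\<C> \<subseteq> C"
        using that unfolding \<A>_def by blast
      moreover have "\<forall>x\<in>\<Inter>\<C>. \<forall>y\<in>\<Inter>\<C>. f x y \<in> \<Inter>\<C>"
        using that unfolding \<A>_def by blast
      ultimately show ?thesis
        using that(3) unfolding \<A>_def by blast
    qed
  qed
  then obtain D where D: "D \<in> \<A>" and minimal: "\<And>E. \<lbrakk>E \<in> \<A>; E \<subseteq> D\<rbrakk> \<Longrightarrow> E = D"
    by blast
  have D': "closedin X D" "D \<subseteq> C" "\<And>x y. x \<in> D \<Longrightarrow> y \<in> D \<Longrightarrow> f x y \<in> D" and ne: "D \<noteq> {}"
    using D by (auto simp: \<A>_def)
  then have DX: "\<And>x. x \<in> D \<Longrightarrow> x \<in> topspace X"
    using closedin_subset by blast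
  obtain x where x: "x \<in> D"
    using ne by blast
  have "(\<lambda>p. f p x) ` D \<in> \<A>"
  proof -
    \<comment> \<open>By associativity this product is the right translate by \<open>x\<close> of
      \<open>f (f a x) b\<close>.\<close>
    have "f (f a x) (f b x) \<in> (\<lambda>p. f p x) ` D" if "a \<in> D" "b \<in> D" for a b
      using that x by (intro image_eqI[of _ _ "f (f a x) b"]) (auto simp: assoc DX mem D')
    moreover have "(\<lambda>p. f p x) ` D \<subseteq> C"
      using D'(2,3) x by blast
    moreover have "closedin X ((\<lambda>p. f p x) ` D)"
      using D'(1) DX x by (intro closedin_right_translate)
    ultimately show ?thesis
      using ne unfolding \<A>_def by simp
  qed
  then have "(\<lambda>p. f p x) ` D = D"
    using D'(3) x by (intro minimal) auto
  then obtain y where y: "y \<in> D" "f y x = x"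
    using x by (metis imageE)
  define E where "E = {p \<in> topspace X. f p x \<in> {x}} \<inter> D"
  have "closedin X E"
    unfolding E_def
  proof (rule closedin_Int[OF closedin_continuous_map_preimage \<open>closedin X D\<close>])
    show "continuous_map X X (\<lambda>p. f p x)"
      using continuous DX[OF x] .
    show "closedin X {x}"
      using closedin_Hausdorff_singleton[OF Hausdorff DX[OF x]] .
  qed
  moreover have "f a b \<in> E" if "a \<in> E" "b \<in> E" for a b
    using that by (auto simp: E_def mem D' x DX assoc)
  moreover have "y \<in> E" "E \<subseteq> D"
    using y DX by (auto simp: E_def)
  ultimately have "E \<in> \<A>"
    using D'(2) unfolding \<A>_def by blast
  then have "E = D"
    using minimal \<open>E \<subseteq> D\<close> by blast
  then have "f x x = x"
    using x by (auto simp: E_def)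
  then show thesis
    using that x D'(2) by blast
qed

section \<open>Minimal left ideals and the smallest ideal\<close>

definition minimal_left :: "'b set \<Rightarrow> bool" where
  "minimal_left L \<longleftrightarrow> L \<noteq> {} \<and> L \<subseteq> topspace X \<and> (\<forall>x\<in>L. (\<lambda>a. f a x) ` topspace X = L)"

lemma minimal_left_mem:
  "\<lbrakk>minimal_left L; a \<in> topspace X; x \<in> L\<rbrakk> \<Longrightarrow> f a x \<in> L"
  unfolding minimal_left_def by (metis image_eqI)

text \<open>Principal left ideals are closed, being continuous images of a compact space. A minimal
  closed left ideal therefore equals the principal left ideal of each of its elements, which is the
  form of minimality that \<open>minimal_left\<close> records.\<close>

lemma ex_minimal_left:
  assumes q: "q \<in> topspace X"
  obtains L where "minimal_left L" "closedin X L" "L \<subseteq> (\<lambda>a. f a q) ` topspace X"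
proof -
  define \<A> where "\<A> = {D. closedin X D \<and> D \<noteq> {} \<and> D \<subseteq> (\<lambda>a. f a q) ` topspace X \<and>
    (\<forall>a\<in>topspace X. \<forall>x\<in>D. f a x \<in> D)}"
  have principal: "closedin X ((\<lambda>a. f a x) ` topspace X)" "(\<lambda>a. f a x) ` topspace X \<noteq> {}"
    "\<And>a y. a \<in> topspace X \<Longrightarrow> y \<in> (\<lambda>a. f a x) ` topspace X \<Longrightarrow> f a y \<in> (\<lambda>a. f a x) ` topspace X"
    if "x \<in> topspace X" for x
    using that by (auto simp: closedin_right_translate assoc[symmetric] mem)
  have "\<exists>D\<in>\<A>. \<forall>E\<in>\<A>. E \<subseteq> D \<longrightarrow> E = D"
  proof (rule compact_space_minimal_closed[OF compact, of \<A>])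
    show "\<A> \<noteq> {}"
      using principal[OF q] unfolding \<A>_def by blast
    show "closedin X D \<and> D \<noteq> {}" if "D \<in> \<A>" for D
      using that by (auto simp: \<A>_def)
    show "\<Inter>\<C> \<in> \<A>" if "\<C> \<subseteq> \<A>" "\<C> \<noteq> {}" "\<Inter>\<C> \<noteq> {}" for \<C>
    proof -
      have "closedin X (\<Inter>\<C>)"
        using that by (intro closedin_Inter) (auto simp: \<A>_def)
      moreover have "\<Inter>\<C> \<subseteq> (\<lambda>a. f a q) ` topspace X"
        using that unfolding \<A>_def by blast
      moreover have "\<forall>a\<in>topspace X. \<forall>x\<in>\<Inter>\<C>. f a x \<in> \<Inter>\<C>"
        using that unfolding \<A>_def by blast
      ultimately show ?thesis
        using that(3) unfolding \<A>_def by blast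
    qed
  qed
  then obtain D where D: "D \<in> \<A>" and minimal: "\<And>E. \<lbrakk>E \<in> \<A>; E \<subseteq> D\<rbrakk> \<Longrightarrow> E = D"
    by blast
  have D': "closedin X D" "D \<noteq> {}" "D \<subseteq> (\<lambda>a. f a q) ` topspace X"
    "\<And>a x. a \<in> topspace X \<Longrightarrow> x \<in> D \<Longrightarrow> f a x \<in> D"
    using D by (auto simp: \<A>_def)
  have "(\<lambda>a. f a x) ` topspace X = D" if "x \<in> D" for x
  proof (rule minimal)
    show sub: "(\<lambda>a. f a x) ` topspace X \<subseteq> D"
      using D'(4) that by blast
    have "x \<in> topspace X"
      using D'(1) that closedin_subset by blast
    from principal[OF this] sub D'(3) show "(\<lambda>a. f a x) ` topspace X \<in> \<A>"
      unfolding \<A>_def by blast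
  qed
  then have "minimal_left D"
    using D'(1,2) closedin_subset unfolding minimal_left_def by blast
  then show thesis
    using that D' by blast
qed

text \<open>For \<open>x\<close> in \<open>L\<close> and \<open>a\<close> in an ideal
  \<open>J\<close>, the element \<open>f a x\<close> lies in both. Its left multiples fill
  \<open>L\<close>, so \<open>x\<close> is one of them and belongs to \<open>J\<close>.\<close>

lemma minimal_left_subset_smallest_ideal:
  assumes "minimal_left L"
  shows "L \<subseteq> smallest_ideal (topspace X) f"
proof -
  have "x \<in> J" if x: "x \<in> L" and J: "ideal_on (topspace X) f J" for x J
  proof -
    obtain a where a: "a \<in> J" "a \<in> topspace X"
      using J by (auto simp: ideal_on_def)
    have "f a x \<in> L"
      using minimal_left_mem assms a x by blast
    then have "x \<in> (\<lambda>b. f b (f a x)) ` topspace X"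
      using assms x by (auto simp: minimal_left_def)
    then obtain b where b: "b \<in> topspace X" "x = f b (f a x)"
      by blast
    have "f a x \<in> J"
      using J a x assms by (auto simp: ideal_on_def minimal_left_def)
    then have "f b (f a x) \<in> J"
      using J b(1) by (auto simp: ideal_on_def)
    then show ?thesis
      using b(2) by simp
  qed
  then show ?thesis
    using assms by (auto simp: smallest_ideal_def minimal_left_def)
qed

text \<open>By associativity the principal left ideal of \<open>f y c\<close> is the right translate
  by \<open>c\<close> of that of \<open>y\<close>. This makes the union of all minimal left ideals a
  right ideal as well.\<close>

lemma minimal_left_right_translate:
  assumes L: "minimal_left L" and c: "c \<in> topspace X"
  shows "minimal_left ((\<lambda>y. f y c) ` L)"
proof -
  have sub: "L \<subseteq> topspace X"
    using L by (simp add: minimal_left_def)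
  have "(\<lambda>a. f a (f y c)) ` topspace X = (\<lambda>y. f y c) ` L" if "y \<in> L" for y
  proof -
    have "(\<lambda>a. f a (f y c)) ` topspace X = (\<lambda>z. f z c) ` (\<lambda>a. f a y) ` topspace X"
      using sub that c by (auto simp: image_image assoc subset_iff)
    also have "(\<lambda>a. f a y) ` topspace X = L"
      using L that by (simp add: minimal_left_def)
    finally show ?thesis .
  qed
  then show ?thesis
    using L c sub by (auto simp: minimal_left_def mem)
qed

text \<open>The union of the minimal left ideals is a two-sided ideal, so \<open>p\<close> lies in
  some minimal left ideal. There the left multiples of \<open>f x p\<close> reach every element,
  including \<open>p\<close>.\<close>

lemma smallest_ideal_left_solvable:
  assumes p: "p \<in> smallest_ideal (topspace X) f" and x: "x \<in> topspace X"
  obtains u where "u \<in> topspace X" "f u (f x p) = p"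
proof -
  have pX: "p \<in> topspace X"
    using p by (simp add: smallest_ideal_def)
  have "ideal_on (topspace X) f (\<Union>{L. minimal_left L})"
    unfolding ideal_on_def
  proof (intro conjI ballI)
    show "\<Union>{L. minimal_left L} \<subseteq> topspace X"
      by (auto simp: minimal_left_def)
    show "\<Union>{L. minimal_left L} \<noteq> {}"
      using ex_minimal_left[OF pX] minimal_left_def by (metis Union_upper mem_Collect_eq subset_empty)
    fix a y assume "a \<in> topspace X" "y \<in> \<Union>{L. minimal_left L}"
    then show "f a y \<in> \<Union>{L. minimal_left L}" "f y a \<in> \<Union>{L. minimal_left L}"
      using minimal_left_mem minimal_left_right_translate by blast+
  qed
  then obtain L where L: "minimal_left L" "p \<in> L"
    using p by (auto simp: smallest_ideal_def)
  then have "f x p \<in> L"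
    using minimal_left_mem x by blast
  then have "p \<in> (\<lambda>a. f a (f x p)) ` topspace X"
    using L by (simp add: minimal_left_def)
  then obtain u where u: "u \<in> topspace X" "p = f u (f x p)"
    by (elim imageE)
  show thesis
    by (rule that[OF u(1) u(2)[symmetric]])
qed

end

section \<open>Ultrafilters along a filter base\<close>

text \<open>Zorn's lemma gives a maximal proper filter containing \<open>\<B>\<close>, and
  maximality makes it an ultrafilter.\<close>

lemma ex_ultrafilter:
  assumes sub: "\<B> \<subseteq> Pow S" and ne: "\<B> \<noteq> {}" and empty: "{} \<notin> \<B>"
    and dir: "\<And>A B. \<lbrakk>A \<in> \<B>; B \<in> \<B>\<rbrakk> \<Longrightarrow> \<exists>C\<in>\<B>. C \<subseteq> A \<inter> B"
  shows "\<exists>p. ultrafilter_on S p \<and> \<B> \<subseteq> p"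
proof -
  define \<A> where "\<A> = {p. \<B> \<subseteq> p \<and> p \<subseteq> Pow S \<and> {} \<notin> p \<and>
    (\<forall>A\<in>p. \<forall>B\<in>p. A \<inter> B \<in> p) \<and> (\<forall>A\<in>p. \<forall>B. A \<subseteq> B \<and> B \<subseteq> S \<longrightarrow> B \<in> p)}"
  have AI: "p \<in> \<A>" if "\<B> \<subseteq> p" "p \<subseteq> Pow S" "{} \<notin> p"
    "\<And>A B. \<lbrakk>A \<in> p; B \<in> p\<rbrakk> \<Longrightarrow> A \<inter> B \<in> p"
    "\<And>A B. \<lbrakk>A \<in> p; A \<subseteq> B; B \<subseteq> S\<rbrakk> \<Longrightarrow> B \<in> p" for p
    unfolding \<A>_def using that by simp
  have AD: "\<B> \<subseteq> p" "p \<subseteq> Pow S" "{} \<notin> p"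
    "\<And>A B. \<lbrakk>A \<in> p; B \<in> p\<rbrakk> \<Longrightarrow> A \<inter> B \<in> p"
    "\<And>A B. \<lbrakk>A \<in> p; A \<subseteq> B; B \<subseteq> S\<rbrakk> \<Longrightarrow> B \<in> p" if "p \<in> \<A>" for p
    using that unfolding \<A>_def by simp_all
  have "\<exists>M\<in>\<A>. \<forall>Y\<in>\<A>. M \<subseteq> Y \<longrightarrow> Y = M"
  proof (rule subset_Zorn_nonempty)
    \<comment> \<open>The filter generated by \<open>\<B>\<close> shows that Zorn's lemma is applied
      to a nonempty family.\<close>
    define q where "q = {A. A \<subseteq> S \<and> (\<exists>B\<in>\<B>. B \<subseteq> A)}"
    have "\<B> \<subseteq> q" "q \<subseteq> Pow S" "{} \<notin> q"
      using sub empty by (auto simp: q_def)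
    moreover have "A \<inter> B \<in> q" if AB: "A \<in> q" "B \<in> q" for A B
    proof -
      obtain A' B' where *: "A \<subseteq> S" "A' \<in> \<B>" "B' \<in> \<B>" "A' \<subseteq> A" "B' \<subseteq> B"
        using AB unfolding q_def by blast
      obtain C where "C \<in> \<B>" "C \<subseteq> A' \<inter> B'"
        using dir[OF *(2,3)] by blast
      with * show ?thesis
        unfolding q_def by blast
    qed
    moreover have "B \<in> q" if "A \<in> q" "A \<subseteq> B" "B \<subseteq> S" for A B
      using that unfolding q_def by blast
    ultimately have "q \<in> \<A>"
      by (rule AI)
    then show "\<A> \<noteq> {}"
      by blast
    fix \<C> assume C: "\<C> \<noteq> {}" "subset.chain \<A> \<C>"
    then have CA: "\<C> \<subseteq> \<A>" and lin: "\<And>p q. p \<in> \<C> \<Longrightarrow> q \<in> \<C> \<Longrightarrow> p \<subseteq> q \<or> q \<subseteq> p"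
      by (auto simp: subset_chain_def)
    show "\<Union>\<C> \<in> \<A>"
    proof (rule AI)
      show "\<B> \<subseteq> \<Union>\<C>"
        using C(1) CA AD(1) by (metis Union_upper all_not_in_conv subset_iff)
      show "\<Union>\<C> \<subseteq> Pow S" "{} \<notin> \<Union>\<C>"
        using CA AD(2,3) by (meson Union_least UnionE subsetD)+
      show "A \<inter> B \<in> \<Union>\<C>" if AB: "A \<in> \<Union>\<C>" "B \<in> \<Union>\<C>" for A B
      proof -
        obtain p q where pq: "p \<in> \<C>" "q \<in> \<C>" "A \<in> p" "B \<in> q"
          using AB by blast
        from lin[OF pq(1,2)] obtain r where r: "r \<in> \<C>" "A \<in> r" "B \<in> r"
          using pq by blast
        then show ?thesis
          using AD(4)[of r A B] CA by blast
      qed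
      show "B \<in> \<Union>\<C>" if "A \<in> \<Union>\<C>" "A \<subseteq> B" "B \<subseteq> S" for A B
        using that CA AD(5) by (meson UnionE UnionI subsetD)
    qed
  qed
  then obtain p where p: "p \<in> \<A>" and maximal: "\<And>q. q \<in> \<A> \<Longrightarrow> p \<subseteq> q \<Longrightarrow> q = p"
    by blast
  note p' = AD[OF p]
  have ultra: "S - A \<in> p" if A: "A \<subseteq> S" "A \<notin> p" for A
  proof -
    \<comment> \<open>This is the filter generated by \<open>p\<close> and \<open>A\<close>. It is
      strictly larger than \<open>p\<close>, so it cannot be proper, and some member of
      \<open>p\<close> misses \<open>A\<close>.\<close>
    define q where "q = {B. B \<subseteq> S \<and> (\<exists>C\<in>p. C \<inter> A \<subseteq> B)}"
    have "p \<subseteq> q"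
      using p'(2) by (auto simp: q_def)
    obtain B where "B \<in> p"
      using p'(1) ne by blast
    then have "A \<in> q"
      using A by (auto simp: q_def)
    then have "q \<noteq> p"
      using A by blast
    then have "q \<notin> \<A>"
      using maximal \<open>p \<subseteq> q\<close> by blast
    moreover have "q \<in> \<A>" if "{} \<notin> q"
    proof (rule AI)
      show "\<B> \<subseteq> q" "q \<subseteq> Pow S" "{} \<notin> q"
        using that p'(1) \<open>p \<subseteq> q\<close> by (auto simp: q_def)
      show "B \<inter> C \<in> q" if BC: "B \<in> q" "C \<in> q" for B C
      proof -
        obtain B' C' where "B' \<in> p" "C' \<in> p" "B' \<inter> A \<subseteq> B" "C' \<inter> A \<subseteq> C"
          using BC by (auto simp: q_def)
        then have "B' \<inter> C' \<in> p" "(B' \<inter> C') \<inter> A \<subseteq> B \<inter> C"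
          using p'(4) by auto
        then show ?thesis
          using BC unfolding q_def by blast
      qed
      show "C \<in> q" if "B \<in> q" "B \<subseteq> C" "C \<subseteq> S" for B C
        using that unfolding q_def by blast
    qed
    ultimately obtain C where C: "C \<in> p" "C \<inter> A = {}"
      by (auto simp: q_def)
    then have "C \<subseteq> S - A"
      using p'(2) by blast
    then show ?thesis
      using p'(5) C(1) by blast
  qed
  have "S \<in> p"
    using p'(1,2) p'(5)[of _ S] ne by blast
  have "ultrafilter_on S p"
    unfolding ultrafilter_on_def
  proof (intro conjI ballI allI impI)
    show "A \<in> p \<or> S - A \<in> p" if "A \<subseteq> S" for A
      using ultra that by blast
    show "B \<in> p" if "A \<in> p" "A \<subseteq> B \<and> B \<subseteq> S" for A B
      using p'(5) that by blast
  qed (use \<open>S \<in> p\<close> p'(2-4) in auto)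
  then show ?thesis
    using p'(1) by blast
qed

lemma ultrafilter_onD:
  assumes "ultrafilter_on S p"
  shows "S \<in> p" "{} \<notin> p"
    and "\<And>A. A \<in> p \<Longrightarrow> A \<subseteq> S"
    and "\<And>A B. \<lbrakk>A \<in> p; B \<in> p\<rbrakk> \<Longrightarrow> A \<inter> B \<in> p"
    and "\<And>A B. \<lbrakk>A \<in> p; A \<subseteq> B; B \<subseteq> S\<rbrakk> \<Longrightarrow> B \<in> p"
    and "\<And>A. A \<subseteq> S \<Longrightarrow> S - A \<in> p \<longleftrightarrow> A \<notin> p"
proof -
  note u = assms[unfolded ultrafilter_on_def]
  show "S \<in> p" "{} \<notin> p" "\<And>A. A \<in> p \<Longrightarrow> A \<subseteq> S"
    "\<And>A B. \<lbrakk>A \<in> p; B \<in> p\<rbrakk> \<Longrightarrow> A \<inter> B \<in> p"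
    "\<And>A B. \<lbrakk>A \<in> p; A \<subseteq> B; B \<subseteq> S\<rbrakk> \<Longrightarrow> B \<in> p"
    using u by blast+
  show "S - A \<in> p \<longleftrightarrow> A \<notin> p" if "A \<subseteq> S" for A
    using u that by (metis Diff_disjoint)
qed

lemma ultrafilter_on_eqI:
  assumes p: "ultrafilter_on S p" and q: "ultrafilter_on S q" and "p \<subseteq> q"
  shows "p = q"
proof
  show "q \<subseteq> p"
  proof
    fix A assume A: "A \<in> q"
    then have "A \<subseteq> S" "S - A \<notin> q"
      using ultrafilter_onD(3,6)[OF q] by auto
    then show "A \<in> p"
      using ultrafilter_onD(6)[OF p, of A] \<open>p \<subseteq> q\<close> by blast
  qed
qed (rule \<open>p \<subseteq> q\<close>)

lemma ultrafilter_on_finite_Inter: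
  assumes "ultrafilter_on S p" "finite J" "\<And>j. j \<in> J \<Longrightarrow> {x \<in> S. P j x} \<in> p"
  shows "{x \<in> S. \<forall>j\<in>J. P j x} \<in> p"
  using assms(2,3)
proof (induction J rule: finite_induct)
  case empty
  then show ?case
    using ultrafilter_onD(1)[OF assms(1)] by simp
next
  case (insert j J)
  have "{x \<in> S. \<forall>k\<in>insert j J. P k x} = {x \<in> S. P j x} \<inter> {x \<in> S. \<forall>k\<in>J. P k x}"
    by blast
  then show ?case
    using insert ultrafilter_onD(4)[OF assms(1)] by auto
qed

lemma ultrafilter_on_finite_Union:
  assumes p: "ultrafilter_on S p" and "finite \<F>" "\<F> \<subseteq> Pow S" "\<Union>\<F> \<in> p"
  shows "\<exists>A\<in>\<F>. A \<in> p"
proof (rule ccontr)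
  assume neg: "\<not> (\<exists>A\<in>\<F>. A \<in> p)"
  have "{x \<in> S. \<forall>A\<in>\<F>. x \<notin> A} \<in> p"
  proof (rule ultrafilter_on_finite_Inter[OF p \<open>finite \<F>\<close>])
    fix A assume "A \<in> \<F>"
    then have "S - A \<in> p"
      using ultrafilter_onD(6)[OF p] neg assms(3) by blast
    moreover have "S - A = {x \<in> S. x \<notin> A}"
      by blast
    ultimately show "{x \<in> S. x \<notin> A} \<in> p"
      by simp
  qed
  then have "{x \<in> S. \<forall>A\<in>\<F>. x \<notin> A} \<inter> \<Union>\<F> \<in> p"
    using ultrafilter_onD(4)[OF p] assms(4) by blast
  moreover have "{x \<in> S. \<forall>A\<in>\<F>. x \<notin> A} \<inter> \<Union>\<F> = {}"
    by blast
  ultimately show False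
    using ultrafilter_onD(2)[OF p] by simp
qed

section \<open>The compact space of ultrafilters extending a filter base\<close>

definition star :: "'a set \<Rightarrow> 'a set set \<Rightarrow> 'a set set set" where
  "star S N = {p. ultrafilter_on S p \<and> N \<subseteq> p}"

text \<open>The subspace topology inherited from the Stone topology on
  \<open>beta S\<close>.\<close>

definition star_topology :: "'a set \<Rightarrow> 'a set set \<Rightarrow> 'a set set topology" where
  "star_topology S N = topology_generated_by ((\<lambda>A. {p \<in> star S N. A \<in> p}) ` Pow S)"

locale base_on =
  fixes S :: "'a set" and N :: "'a set set"
  assumes base_ne: "N \<noteq> {}"
    and base_sub: "\<And>U. U \<in> N \<Longrightarrow> U \<subseteq> S"
    and base_mem_ne: "\<And>U. U \<in> N \<Longrightarrow> U \<noteq> {}"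
    and base_dir: "\<And>U V. \<lbrakk>U \<in> N; V \<in> N\<rbrakk> \<Longrightarrow> \<exists>W\<in>N. W \<subseteq> U \<inter> V"
begin

lemma starD:
  assumes "p \<in> star S N"
  shows "ultrafilter_on S p" "N \<subseteq> p"
  using assms by (auto simp: star_def)

lemma topspace_star_topology [simp]: "topspace (star_topology S N) = star S N"
  by (auto simp: star_topology_def intro!: bexI[of _ S] dest: starD(1)[THEN ultrafilter_onD(1)])

lemma openin_star_basic: "A \<subseteq> S \<Longrightarrow> openin (star_topology S N) {p \<in> star S N. A \<in> p}"
  by (auto simp: star_topology_def intro!: topology_generated_by_Basis)

lemma closedin_star_basic:
  assumes "A \<subseteq> S"
  shows "closedin (star_topology S N) {p \<in> star S N. A \<in> p}"
proof -
  have eq: "star S N - {p \<in> star S N. A \<in> p} = {p \<in> star S N. S - A \<in> p}"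
    using ultrafilter_onD(6)[OF starD(1) assms] by auto
  show ?thesis
    unfolding closedin_def topspace_star_topology eq
    using openin_star_basic[of "S - A"] by auto
qed

text \<open>The generating sets are already a base: those of \<open>A\<close> and \<open>B\<close>
  meet in that of \<open>A \<inter> B\<close>.\<close>

lemma openin_starD:
  assumes "openin (star_topology S N) W" "p \<in> W"
  shows "\<exists>A\<in>p. {q \<in> star S N. A \<in> q} \<subseteq> W"
proof -
  have u: "ultrafilter_on S p"
    using assms openin_subset starD(1) by fastforce
  have "generate_topology_on ((\<lambda>A. {p \<in> star S N. A \<in> p}) ` Pow S) W"
    using assms(1) by (simp add: star_topology_def openin_topology_generated_by)
  then show ?thesis
    using assms(2)
  proof (induction W)
    case (Int a b)
    obtain A B where AB: "A \<in> p" "B \<in> p" "{q \<in> star S N. A \<in> q} \<subseteq> a" "{q \<in> star S N. B \<in> q} \<subseteq> b"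
      using Int by blast
    have "A \<in> q \<and> B \<in> q" if "q \<in> star S N" "A \<inter> B \<in> q" for q
      using ultrafilter_onD(5)[OF starD(1)[OF that(1)] that(2)] ultrafilter_onD(3)[OF u] AB(1,2)
      by blast
    then have "{q \<in> star S N. A \<inter> B \<in> q} \<subseteq> a \<inter> b"
      using AB by blast
    then show ?case
      using ultrafilter_onD(4)[OF u] AB(1,2) by blast
  qed blast+
qed

lemma Hausdorff_space_star: "Hausdorff_space (star_topology S N)"
  unfolding Hausdorff_space_def
proof (intro allI impI, elim conjE)
  fix p q assume pq: "p \<in> topspace (star_topology S N)" "q \<in> topspace (star_topology S N)" "p \<noteq> q"
  then have u: "ultrafilter_on S p" "ultrafilter_on S q"
    by (auto simp: star_def)
  then obtain A where A: "A \<in> p" "A \<notin> q"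
    using ultrafilter_on_eqI pq(3) by blast
  then have AS: "A \<subseteq> S"
    using ultrafilter_onD(3)[OF u(1)] by blast
  then have "S - A \<in> q"
    using A(2) ultrafilter_onD(6)[OF u(2)] by blast
  moreover have "disjnt {r \<in> star S N. A \<in> r} {r \<in> star S N. S - A \<in> r}"
    using ultrafilter_onD(6)[OF starD(1)] AS by (auto simp: disjnt_def)
  ultimately show "\<exists>U V. openin (star_topology S N) U \<and> openin (star_topology S N) V \<and>
      p \<in> U \<and> q \<in> V \<and> disjnt U V"
    using A(1) AS pq(1,2) openin_star_basic[of A] openin_star_basic[of "S - A"]
    by (metis (no_types, lifting) Diff_subset mem_Collect_eq topspace_star_topology)
qed

text \<open>An ultrafilter containing a filter base that refines \<open>N\<close> contains
  \<open>N\<close> by upward closure. This reduces later constructions of points of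
  \<open>star S N\<close> to the choice of \<open>\<B>\<close>.\<close>

lemma ex_star:
  assumes "\<B> \<subseteq> Pow S" "{} \<notin> \<B>" "\<And>A B. \<lbrakk>A \<in> \<B>; B \<in> \<B>\<rbrakk> \<Longrightarrow> \<exists>C\<in>\<B>. C \<subseteq> A \<inter> B"
    and "\<And>U. U \<in> N \<Longrightarrow> \<exists>B\<in>\<B>. B \<subseteq> U"
  shows "\<exists>p\<in>star S N. \<B> \<subseteq> p"
proof -
  have "\<B> \<noteq> {}"
    using assms(4) base_ne by blast
  then obtain p where p: "ultrafilter_on S p" "\<B> \<subseteq> p"
    using ex_ultrafilter[OF assms(1) _ assms(2,3)] by blast
  have "U \<in> p" if U: "U \<in> N" for U
    using assms(4)[OF U] base_sub[OF U] p ultrafilter_onD(5)[OF p(1)] by blast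
  then show ?thesis
    using p by (auto simp: star_def)
qed

lemma compact_space_star: "compact_space (star_topology S N)"
  unfolding compact_space_alt topspace_star_topology
proof (intro allI impI, elim conjE, rule ccontr)
  fix \<U> assume "\<forall>U\<in>\<U>. openin (star_topology S N) U"
    and cover: "star S N \<subseteq> \<Union>\<U>"
    and neg: "\<not> (\<exists>\<F>. finite \<F> \<and> \<F> \<subseteq> \<U> \<and> star S N \<subseteq> \<Union>\<F>)"
  then have opens: "\<And>U. U \<in> \<U> \<Longrightarrow> openin (star_topology S N) U"
    by blast
  \<comment> \<open>\<open>\<A>\<close> collects the sets whose basic open set lies in a single
    member of the cover. Without a finite subcover, no finite union of them contains a member of
    \<open>N\<close>, so the differences in \<open>\<B>\<close> form a filter base. An ultrafilter
    through \<open>\<B>\<close> is then a point that the cover misses.\<close>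
  define \<A> where "\<A> = {A. A \<subseteq> S \<and> (\<exists>U\<in>\<U>. {q \<in> star S N. A \<in> q} \<subseteq> U)}"
  define \<B> where "\<B> = {V - \<Union>\<F> | V \<F>. V \<in> N \<and> finite \<F> \<and> \<F> \<subseteq> \<A>}"
  have "\<exists>p\<in>star S N. \<B> \<subseteq> p"
  proof (rule ex_star)
    show "\<B> \<subseteq> Pow S"
      using base_sub by (auto simp: \<B>_def)
    show "{} \<notin> \<B>"
    proof
      assume "{} \<in> \<B>"
      then obtain V \<F> where V: "V \<in> N" "finite \<F>" "\<F> \<subseteq> \<A>" "V \<subseteq> \<Union>\<F>"
        by (auto simp: \<B>_def)
      have "\<forall>A\<in>\<F>. \<exists>U\<in>\<U>. {q \<in> star S N. A \<in> q} \<subseteq> U"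
        using V(3) by (auto simp: \<A>_def)
      then obtain U where U: "\<And>A. A \<in> \<F> \<Longrightarrow> U A \<in> \<U> \<and> {q \<in> star S N. A \<in> q} \<subseteq> U A"
        by metis
      have FS: "\<F> \<subseteq> Pow S"
        using V(3) by (auto simp: \<A>_def)
      \<comment> \<open>The ultrafilter \<open>q\<close> contains \<open>V\<close>, hence the finite
        union, hence one member of \<open>\<F>\<close>. So the finitely many sets \<open>U A\<close>
        would cover the space.\<close>
      have "q \<in> \<Union>(U ` \<F>)" if q: "q \<in> star S N" for q
      proof -
        have "\<Union>\<F> \<in> q"
          using starD[OF q] V(1,4) FS ultrafilter_onD(5)[OF starD(1)[OF q], of V "\<Union>\<F>"] by blast
        then show ?thesis
          using ultrafilter_on_finite_Union[OF starD(1)[OF q] V(2) FS] U q by blast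
      qed
      then show False
        using neg V(2) U by (metis (no_types, lifting) finite_imageI image_subsetI subsetI)
    qed
    show "\<exists>C\<in>\<B>. C \<subseteq> A \<inter> B" if AB: "A \<in> \<B>" "B \<in> \<B>" for A B
    proof -
      obtain V \<F> V' \<F>' where *: "V \<in> N" "finite \<F>" "\<F> \<subseteq> \<A>" "A = V - \<Union>\<F>"
        "V' \<in> N" "finite \<F>'" "\<F>' \<subseteq> \<A>" "B = V' - \<Union>\<F>'"
        using AB unfolding \<B>_def by blast
      obtain W where W: "W \<in> N" "W \<subseteq> V \<inter> V'"
        using base_dir * by meson
      have "W - \<Union>(\<F> \<union> \<F>') \<in> \<B>"
        unfolding \<B>_def using W(1) * by (intro CollectI exI[of _ W] exI[of _ "\<F> \<union> \<F>'"]) auto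
      moreover have "W - \<Union>(\<F> \<union> \<F>') \<subseteq> A \<inter> B"
        using W(2) * by blast
      ultimately show ?thesis
        by blast
    qed
    show "\<exists>B\<in>\<B>. B \<subseteq> U" if "U \<in> N" for U
      unfolding \<B>_def using that by blast
  qed
  then obtain p where p: "p \<in> star S N" "\<B> \<subseteq> p"
    by blast
  then obtain U where U: "U \<in> \<U>" "p \<in> U"
    using cover by blast
  obtain A where A: "A \<in> p" "{q \<in> star S N. A \<in> q} \<subseteq> U"
    using openin_starD[OF opens[OF U(1)] U(2)] by blast
  note u = starD(1)[OF p(1)]
  have "A \<in> \<A>"
    using A U(1) ultrafilter_onD(3)[OF u] by (auto simp: \<A>_def)
  obtain V where "V \<in> N"
    using base_ne by blast
  \<comment> \<open>The singleton family \<open>{A}\<close> forces a set disjoint from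
    \<open>A\<close> into \<open>p\<close>, although \<open>A\<close> is in
    \<open>p\<close>.\<close>
  have "V - \<Union>{A} \<in> \<B>"
    unfolding \<B>_def using \<open>A \<in> \<A>\<close> \<open>V \<in> N\<close> by blast
  then have "A \<inter> (V - \<Union>{A}) \<in> p"
    using p(2) A(1) ultrafilter_onD(4)[OF u] by blast
  then show False
    using ultrafilter_onD(2)[OF u] by (simp add: Int_Diff)
qed

end

section \<open>The operation on ultrafilters\<close>

lemma beta_op_iff:
  "A \<in> beta_op S f p q \<longleftrightarrow> A \<subseteq> S \<and> {x \<in> S. {y \<in> S. f x y \<in> A} \<in> q} \<in> p"
  by (simp add: beta_op_def)

text \<open>The map \<open>D\<close> respects intersections, inclusions, complements and the two
  extreme sets, so pulling the ultrafilter \<open>p\<close> back along it gives an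
  ultrafilter.\<close>

lemma ultrafilter_on_beta_op:
  assumes f: "semigroup_on S f" and p: "ultrafilter_on S p" and q: "ultrafilter_on S q"
  shows "ultrafilter_on S (beta_op S f p q)"
proof -
  note P = ultrafilter_onD[OF p] and Q = ultrafilter_onD[OF q]
  define D where "D A = {x \<in> S. {y \<in> S. f x y \<in> A} \<in> q}" for A
  have op: "A \<in> beta_op S f p q \<longleftrightarrow> A \<subseteq> S \<and> D A \<in> p" for A
    by (simp add: beta_op_iff D_def)
  have "D S = S"
    using semigroup_onD(1)[OF f] Q(1) by (auto simp: D_def cong: conj_cong)
  moreover have "D {} = {}"
    using Q(2) by (simp add: D_def)
  moreover have "D A \<inter> D B \<subseteq> D (A \<inter> B)" for A B
  proof
    fix x assume "x \<in> D A \<inter> D B"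
    then have "x \<in> S" "{y \<in> S. f x y \<in> A} \<inter> {y \<in> S. f x y \<in> B} \<in> q"
      using Q(4) by (auto simp: D_def)
    moreover have "{y \<in> S. f x y \<in> A} \<inter> {y \<in> S. f x y \<in> B} = {y \<in> S. f x y \<in> A \<inter> B}"
      by blast
    ultimately show "x \<in> D (A \<inter> B)"
      by (simp add: D_def)
  qed
  moreover have mono: "D A \<subseteq> D B" if "A \<subseteq> B" for A B
    using that Q(5) unfolding D_def by (smt (verit) Collect_mono_iff mem_Collect_eq subsetI subset_iff)
  moreover have "D (S - A) = S - D A" if "A \<subseteq> S" for A
  proof -
    have "{y \<in> S. f x y \<in> S - A} = S - {y \<in> S. f x y \<in> A}" if "x \<in> S" for x
      using semigroup_onD(1)[OF f] that by blast
    then show ?thesis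
      using Q(6) by (auto simp: D_def)
  qed
  moreover have "D A \<subseteq> S" for A
    by (auto simp: D_def)
  ultimately show ?thesis
    unfolding ultrafilter_on_def using P
    by (smt (verit, best) Diff_subset Int_lower1 PowI op subsetI subset_trans)
qed

text \<open>The condition \<open>base_op\<close> extracts what separate continuity gives at an
  idempotent point. The choice of \<open>W\<close> after \<open>x\<close> reflects that continuity
  is separate rather than joint.\<close>

locale near_semigroup = base_on S N for S :: "'a set" and N :: "'a set set" +
  fixes f :: "'a \<Rightarrow> 'a \<Rightarrow> 'a"
  assumes semigroup: "semigroup_on S f"
    and base_op: "\<And>U. U \<in> N \<Longrightarrow> \<exists>V\<in>N. \<forall>x\<in>V. \<exists>W\<in>N. \<forall>y\<in>W. f x y \<in> U"
begin

text \<open>The quantifiers of \<open>base_op\<close> match the definition of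
  \<open>beta_op\<close>: \<open>V\<close> belongs to \<open>p\<close> and, for each
  \<open>x\<close> in \<open>V\<close>, the set \<open>W\<close> belongs to
  \<open>q\<close>.\<close>

lemma beta_op_star:
  assumes p: "p \<in> star S N" and q: "q \<in> star S N"
  shows "beta_op S f p q \<in> star S N"
proof -
  have "U \<in> beta_op S f p q" if U: "U \<in> N" for U
  proof -
    obtain V where V: "V \<in> N" "\<And>x. x \<in> V \<Longrightarrow> \<exists>W\<in>N. \<forall>y\<in>W. f x y \<in> U"
      using base_op[OF U] by blast
    have "{y \<in> S. f x y \<in> U} \<in> q" if x: "x \<in> V" for x
    proof -
      obtain W where "W \<in> N" "\<forall>y\<in>W. f x y \<in> U"
        using V(2)[OF x] by blast
      then show ?thesis
        using starD[OF q] ultrafilter_onD(5)[OF starD(1)[OF q], of W "{y \<in> S. f x y \<in> U}"] base_sub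
        by blast
    qed
    then have "V \<subseteq> {x \<in> S. {y \<in> S. f x y \<in> U} \<in> q}"
      using base_sub[OF V(1)] by blast
    then show ?thesis
      using starD[OF p] ultrafilter_onD(5)[OF starD(1)[OF p], of V] V(1) base_sub[OF U]
      by (auto simp: beta_op_iff)
  qed
  then show ?thesis
    using ultrafilter_on_beta_op[OF semigroup starD(1)[OF p] starD(1)[OF q]]
    by (auto simp: star_def)
qed

text \<open>Both sides test \<open>A\<close> through the same nested sets once associativity in
  \<open>S\<close> has been used to rebracket \<open>f\<close>.\<close>

lemma beta_op_assoc:
  "beta_op S f (beta_op S f p q) r = beta_op S f p (beta_op S f q r)"
proof -
  have "A \<in> beta_op S f (beta_op S f p q) r \<longleftrightarrow> A \<in> beta_op S f p (beta_op S f q r)" for A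
  proof -
    have "{y \<in> S. f x y \<in> {x \<in> S. {y \<in> S. f x y \<in> A} \<in> r}} =
        {y \<in> S. {z \<in> S. f y z \<in> {y \<in> S. f x y \<in> A}} \<in> r}" if "x \<in> S" for x
      using that semigroup_onD[OF semigroup] by (auto cong: conj_cong)
    then show ?thesis
      by (auto simp: beta_op_iff cong: conj_cong)
  qed
  then show ?thesis
    by blast
qed

sublocale compact_right_topological_semigroup "star_topology S N" "beta_op S f"
proof
  show "semigroup_on (topspace (star_topology S N)) (beta_op S f)"
    by (simp add: semigroup_on_def beta_op_star beta_op_assoc)
  fix q assume "q \<in> topspace (star_topology S N)"
  then have q: "q \<in> star S N"
    by simp
  have "openin (star_topology S N) ((\<lambda>p. beta_op S f p q) -` {p \<in> star S N. A \<in> p} \<inter> star S N)"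
    if "A \<subseteq> S" for A
  proof -
    \<comment> \<open>The preimage of a basic open set under right translation by \<open>q\<close>
      is again basic, which gives continuity.\<close>
    have "(\<lambda>p. beta_op S f p q) -` {p \<in> star S N. A \<in> p} \<inter> star S N =
        {p \<in> star S N. {x \<in> S. {y \<in> S. f x y \<in> A} \<in> q} \<in> p}"
      using that q beta_op_star by (auto simp: beta_op_iff)
    then show ?thesis
      using openin_star_basic[of "{x \<in> S. {y \<in> S. f x y \<in> A} \<in> q}"] by auto
  qed
  then show "continuous_map (star_topology S N) (star_topology S N) (\<lambda>p. beta_op S f p q)"
    unfolding star_topology_def[of S N]
    by (intro continuous_on_generated_topo)
      (use q beta_op_star topspace_star_topology in \<open>auto simp: star_topology_def\<close>)
qed (use compact_space_star Hausdorff_space_star in auto)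

end

lemma (in base_on) star_ne: "star S N \<noteq> {}"
proof -
  have "\<exists>p\<in>star S N. N \<subseteq> p"
    using base_sub base_mem_ne base_dir by (intro ex_star) auto
  then show ?thesis
    by blast
qed

lemma (in base_on) star_eqI:
  assumes "p \<in> star S N" "q \<in> star S N" "p \<subseteq> q"
  shows "p = q"
  using ultrafilter_on_eqI starD(1) assms by blast

text \<open>In \<open>beta S\<close> this says that the left ideal generated by \<open>q\<close> lies in the closure of \<open>A\<close>.\<close>

lemma (in base_on) thick_ex_star:
  assumes "U \<in> N"
    and thick: "\<And>F V. \<lbrakk>finite F; F \<noteq> {}; F \<subseteq> U; V \<in> N\<rbrakk> \<Longrightarrow> \<exists>x\<in>V. (\<lambda>y. f y x) ` F \<subseteq> A"
  shows "\<exists>q\<in>star S N. \<forall>y\<in>U. {x \<in> S. f y x \<in> A} \<in> q"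
proof -
  define G where "G F V = {x \<in> V. \<forall>y\<in>F. f y x \<in> A}" for F V
  define \<B> where "\<B> = {G F V | F V. finite F \<and> F \<subseteq> U \<and> V \<in> N}"
  have "\<exists>q\<in>star S N. \<B> \<subseteq> q"
  proof (rule ex_star)
    show "\<B> \<subseteq> Pow S"
      using base_sub by (auto simp: \<B>_def G_def)
    have "\<exists>x. x \<in> G F V" if "finite F" "F \<subseteq> U" "V \<in> N" for F V
    proof (cases "F = {}")
      case True
      then show ?thesis
        using base_mem_ne[OF that(3)] by (auto simp: G_def)
    next
      case False
      then obtain x where "x \<in> V" "(\<lambda>y. f y x) ` F \<subseteq> A"
        using thick \<open>finite F\<close> \<open>F \<subseteq> U\<close> \<open>V \<in> N\<close> by blast
      then show ?thesis
        by (intro exI[of _ x]) (auto simp: G_def)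
    qed
    then show "{} \<notin> \<B>"
      unfolding \<B>_def by blast
    show "\<exists>C\<in>\<B>. C \<subseteq> B \<inter> B'" if BB: "B \<in> \<B>" "B' \<in> \<B>" for B B'
    proof -
      obtain F V F' V' where *: "finite F" "F \<subseteq> U" "V \<in> N" "B = G F V"
        "finite F'" "F' \<subseteq> U" "V' \<in> N" "B' = G F' V'"
        using BB unfolding \<B>_def by blast
      obtain W where W: "W \<in> N" "W \<subseteq> V \<inter> V'"
        using base_dir[OF *(3,7)] by blast
      have "G (F \<union> F') W \<in> \<B>"
        unfolding \<B>_def using * W(1) by (intro CollectI exI[of _ "F \<union> F'"] exI[of _ W]) auto
      moreover have "G (F \<union> F') W \<subseteq> B \<inter> B'"
        using W(2) * by (auto simp: G_def)
      ultimately show ?thesis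
        by blast
    qed
    show "\<exists>B\<in>\<B>. B \<subseteq> V" if "V \<in> N" for V
      using that by (intro bexI[of _ "G {} V"]) (auto simp: \<B>_def G_def)
  qed
  then obtain q where q: "q \<in> star S N" "\<B> \<subseteq> q"
    by blast
  have "{x \<in> S. f y x \<in> A} \<in> q" if y: "y \<in> U" for y
  proof (rule ultrafilter_onD(5)[OF starD(1)[OF q(1)]])
    have "G {y} U \<in> \<B>"
      unfolding \<B>_def using y \<open>U \<in> N\<close> by blast
    then show "G {y} U \<in> q"
      using q(2) by blast
    show "G {y} U \<subseteq> {x \<in> S. f y x \<in> A}"
      using base_sub[OF \<open>U \<in> N\<close>] by (auto simp: G_def)
  qed auto
  then show ?thesis
    using q(1) by blast
qed

section \<open>Traces of neighborhoods\<close>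

definition nbhd_trace :: "'a topology \<Rightarrow> 'a \<Rightarrow> 'a set \<Rightarrow> 'a set set" where
  "nbhd_trace X e S = (\<lambda>U. U \<inter> S) ` nbhds_of X e"

lemma near_star_eq_star: "near_star X e S = star S (nbhd_trace X e S)"
  by (auto simp: near_star_def star_def beta_def nbhd_trace_def)

lemma nbhds_of_openin: "openin X U \<Longrightarrow> x \<in> U \<Longrightarrow> U \<in> nbhds_of X x"
  using openin_subset by (fastforce simp: nbhds_of_def)

lemma near_semigroup_nbhd_trace:
  assumes X: "semitopological_semigroup X f" and S: "near_subsemigroup X f e S"
  shows "near_semigroup S (nbhd_trace X e S) f"
proof
  have e: "e \<in> topspace X" "f e e = e" "e \<in> X closure_of S" and SX: "S \<subseteq> topspace X"
    using S by (auto simp: near_subsemigroup_def)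
  have cont: "continuous_map X X (f a)" "continuous_map X X (\<lambda>x. f x a)" if "a \<in> topspace X" for a
    using X that by (auto simp: semitopological_semigroup_def)
  show "nbhd_trace X e S \<noteq> {}"
    using nbhds_of_openin[OF openin_topspace e(1)] by (auto simp: nbhd_trace_def)
  fix U assume "U \<in> nbhd_trace X e S"
  then obtain U0 O1 where U: "U = U0 \<inter> S" "openin X O1" "e \<in> O1" "O1 \<subseteq> U0"
    by (auto simp: nbhd_trace_def nbhds_of_def)
  show "U \<subseteq> S"
    using U by blast
  show "U \<noteq> {}"
    using U e(3) by (fastforce simp: in_closure_of)
  show "\<exists>W\<in>nbhd_trace X e S. W \<subseteq> U \<inter> V" if "V \<in> nbhd_trace X e S" for V
  proof -
    obtain V0 O2 where V: "V = V0 \<inter> S" "openin X O2" "e \<in> O2" "O2 \<subseteq> V0"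
      using \<open>V \<in> nbhd_trace X e S\<close> by (auto simp: nbhd_trace_def nbhds_of_def)
    have "O1 \<inter> O2 \<in> nbhds_of X e"
      using U V by (intro nbhds_of_openin) auto
    then have "(O1 \<inter> O2) \<inter> S \<in> nbhd_trace X e S"
      by (auto simp: nbhd_trace_def)
    moreover have "(O1 \<inter> O2) \<inter> S \<subseteq> U \<inter> V"
      using U V by blast
    ultimately show ?thesis
      by blast
  qed
  \<comment> \<open>The point \<open>e\<close> lies in this set because
    \<open>f e e = e\<close>.\<close>
  define O2 where "O2 = {x \<in> topspace X. f x e \<in> O1}"
  have "openin X O2"
    using cont(2)[OF e(1)] U(2) by (simp add: O2_def openin_continuous_map_preimage)
  then have "O2 \<inter> S \<in> nbhd_trace X e S"
    using e U(3) nbhds_of_openin[of X O2 e] by (auto simp: O2_def nbhd_trace_def)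
  moreover have "\<exists>W\<in>nbhd_trace X e S. \<forall>y\<in>W. f x y \<in> U" if x: "x \<in> O2 \<inter> S" for x
  proof -
    \<comment> \<open>Now \<open>e\<close> lies in \<open>O3\<close> precisely because
      \<open>x\<close> lies in \<open>O2\<close>, which is why right translation by \<open>e\<close>
      comes first.\<close>
    define O3 where "O3 = {y \<in> topspace X. f x y \<in> O1}"
    have "openin X O3"
      using cont(1)[of x] x U(2) by (simp add: O2_def O3_def openin_continuous_map_preimage)
    then have "O3 \<inter> S \<in> nbhd_trace X e S"
      using e x nbhds_of_openin[of X O3 e] by (auto simp: O2_def O3_def nbhd_trace_def)
    moreover have "f x y \<in> U" if "y \<in> O3 \<inter> S" for y
      using that x U S by (auto simp: O3_def near_subsemigroup_def semigroup_on_def)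
    ultimately show ?thesis
      by blast
  qed
  ultimately show "\<exists>V\<in>nbhd_trace X e S. \<forall>x\<in>V. \<exists>W\<in>nbhd_trace X e S. \<forall>y\<in>W. f x y \<in> U"
    by blast
next
  show "semigroup_on S f"
    using S by (simp add: near_subsemigroup_def)
qed

lemma thick_near_ex_star:
  assumes X: "semitopological_semigroup X f" and S: "near_subsemigroup X f e S"
    and thick: "thick_near X f e S A"
  shows "\<exists>q\<in>star S (nbhd_trace X e S). \<exists>U\<in>nbhd_trace X e S. \<forall>y\<in>U. {x \<in> S. f y x \<in> A} \<in> q"
proof -
  interpret near_semigroup S "nbhd_trace X e S" f
    by (rule near_semigroup_nbhd_trace[OF X S])
  obtain U where U: "U \<in> nbhds_of X e" "\<And>F V. \<lbrakk>finite F; F \<noteq> {}; F \<subseteq> U \<inter> S; V \<in> nbhds_of X e\<rbrakk>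
      \<Longrightarrow> \<exists>x\<in>V \<inter> S. (\<lambda>y. f y x) ` F \<subseteq> A"
    using thick unfolding thick_near_def by metis
  have "U \<inter> S \<in> nbhd_trace X e S"
    using U(1) by (simp add: nbhd_trace_def)
  moreover from this have "\<exists>q\<in>star S (nbhd_trace X e S). \<forall>y\<in>U \<inter> S. {x \<in> S. f y x \<in> A} \<in> q"
    by (rule thick_ex_star) (use U(2) in \<open>auto simp: nbhd_trace_def\<close>)
  ultimately show ?thesis
    by blast
qed

section \<open>Products\<close>

definition box_base :: "'i set \<Rightarrow> ('i \<Rightarrow> 'a set set) \<Rightarrow> ('i \<Rightarrow> 'a) set set" where
  "box_base I N = {Pi\<^sub>E I U | U. \<forall>i\<in>I. U i \<in> N i}"

lemma openin_box: "(\<And>i. i \<in> I \<Longrightarrow> openin (T i) (U i)) \<Longrightarrow> openin (box_topology I T) (Pi\<^sub>E I U)"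
  unfolding box_topology_def by (rule topology_generated_by_Basis) blast

lemma topspace_box_topology: "topspace (box_topology I T) = (\<Pi>\<^sub>E i\<in>I. topspace (T i))"
proof
  have "Pi\<^sub>E I U \<subseteq> (\<Pi>\<^sub>E i\<in>I. topspace (T i))" if "\<forall>i\<in>I. openin (T i) (U i)" for U
    using that by (intro PiE_mono openin_subset) blast
  then show "topspace (box_topology I T) \<subseteq> (\<Pi>\<^sub>E i\<in>I. topspace (T i))"
    unfolding box_topology_def topology_generated_by_topspace by blast
  show "(\<Pi>\<^sub>E i\<in>I. topspace (T i)) \<subseteq> topspace (box_topology I T)"
    by (intro openin_subset openin_box) simp
qed

text \<open>Boxes are closed under binary intersection, so the generating boxes form a base.\<close>

lemma openin_box_topologyD:
  assumes "openin (box_topology I T) W" "x \<in> W"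
  shows "\<exists>U. (\<forall>i\<in>I. openin (T i) (U i)) \<and> x \<in> Pi\<^sub>E I U \<and> Pi\<^sub>E I U \<subseteq> W"
proof -
  have "generate_topology_on {Pi\<^sub>E I U |U. \<forall>i\<in>I. openin (T i) (U i)} W"
    using assms(1) by (simp add: box_topology_def openin_topology_generated_by)
  then show ?thesis
    using assms(2)
  proof (induction W)
    case (Int a b)
    then obtain U V where U: "\<forall>i\<in>I. openin (T i) (U i)" "x \<in> Pi\<^sub>E I U" "Pi\<^sub>E I U \<subseteq> a"
      and V: "\<forall>i\<in>I. openin (T i) (V i)" "x \<in> Pi\<^sub>E I V" "Pi\<^sub>E I V \<subseteq> b"
      by auto
    then have "\<forall>i\<in>I. openin (T i) (U i \<inter> V i)" "x \<in> Pi\<^sub>E I U \<inter> Pi\<^sub>E I V"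
      "Pi\<^sub>E I U \<inter> Pi\<^sub>E I V \<subseteq> a \<inter> b"
      by auto
    then show ?case
      unfolding PiE_Int by (intro exI[of _ "\<lambda>i. U i \<inter> V i"] conjI)
  next
    case (UN K)
    then obtain k where k: "k \<in> K" "x \<in> k"
      by blast
    obtain U where "\<forall>i\<in>I. openin (T i) (U i)" "x \<in> Pi\<^sub>E I U" "Pi\<^sub>E I U \<subseteq> k"
      using UN.IH[OF k] by blast
    then show ?case
      using k(1) by (intro exI[of _ U]) auto
  qed auto
qed

text \<open>Every neighborhood trace contains a box of traces, and every box of traces is a
  neighborhood trace. Hence an ultrafilter contains all sets of one kind iff it contains all of the
  other.\<close>

lemma near_star_box_topology:
  "near_star (box_topology I T) (\<lambda>i\<in>I. e i) (Pi\<^sub>E I S) =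
    star (Pi\<^sub>E I S) (box_base I (\<lambda>i. nbhd_trace (T i) (e i) (S i)))" (is "?L = star _ ?N")
proof -
  have 1: "\<exists>B\<in>?N. B \<subseteq> U \<inter> Pi\<^sub>E I S" if U: "U \<in> nbhds_of (box_topology I T) (\<lambda>i\<in>I. e i)" for U
  proof -
    obtain W where W: "openin (box_topology I T) W" "(\<lambda>i\<in>I. e i) \<in> W" "W \<subseteq> U"
      using U by (auto simp: nbhds_of_def)
    obtain V where V: "\<forall>i\<in>I. openin (T i) (V i)" "(\<lambda>i\<in>I. e i) \<in> Pi\<^sub>E I V" "Pi\<^sub>E I V \<subseteq> W"
      using openin_box_topologyD[OF W(1,2)] by blast
    then have "V i \<inter> S i \<in> nbhd_trace (T i) (e i) (S i)" if "i \<in> I" for i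
      using that nbhds_of_openin[of "T i" "V i" "e i"] by (auto simp: nbhd_trace_def PiE_iff)
    then have "Pi\<^sub>E I V \<inter> Pi\<^sub>E I S \<in> ?N"
      unfolding PiE_Int by (auto simp: box_base_def)
    then show ?thesis
      by (rule bexI[rotated]) (use V(3) W(3) in blast)
  qed
  have 2: "\<exists>U\<in>nbhds_of (box_topology I T) (\<lambda>i\<in>I. e i). B = U \<inter> Pi\<^sub>E I S" if "B \<in> ?N" for B
  proof -
    obtain U where U: "B = Pi\<^sub>E I U" "\<And>i. i \<in> I \<Longrightarrow> U i \<in> nbhd_trace (T i) (e i) (S i)"
      using \<open>B \<in> ?N\<close> by (auto simp: box_base_def)
    \<comment> \<open>An open \<open>W\<close> is chosen along with each neighborhood
      \<open>V\<close>. The box of these \<open>W\<close> is open for arbitrary \<open>I\<close>,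
      since the box topology may restrict all coordinates at once.\<close>
    have "\<forall>i\<in>I. \<exists>V W. U i = V \<inter> S i \<and> V \<subseteq> topspace (T i) \<and> openin (T i) W \<and> e i \<in> W \<and> W \<subseteq> V"
    proof
      fix i assume "i \<in> I"
      then obtain V where "U i = V \<inter> S i" "V \<in> nbhds_of (T i) (e i)"
        using U(2) by (auto simp: nbhd_trace_def)
      then show "\<exists>V W. U i = V \<inter> S i \<and> V \<subseteq> topspace (T i) \<and> openin (T i) W \<and> e i \<in> W \<and> W \<subseteq> V"
        unfolding nbhds_of_def by blast
    qed
    then obtain V W where VW: "\<And>i. i \<in> I \<Longrightarrow> U i = V i \<inter> S i \<and> V i \<subseteq> topspace (T i) \<and>
        openin (T i) (W i) \<and> e i \<in> W i \<and> W i \<subseteq> V i"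
      by metis
    have "Pi\<^sub>E I V \<in> nbhds_of (box_topology I T) (\<lambda>i\<in>I. e i)"
      unfolding nbhds_of_def topspace_box_topology
      using VW by (intro CollectI conjI exI[of _ "Pi\<^sub>E I W"] openin_box PiE_mono) auto
    moreover have "B = Pi\<^sub>E I V \<inter> Pi\<^sub>E I S"
      unfolding U(1) PiE_Int using VW by (intro PiE_cong) auto
    ultimately show ?thesis
      by blast
  qed
  show ?thesis
  proof (intro equalityI subsetI)
    fix p assume "p \<in> ?L"
    then have p: "ultrafilter_on (Pi\<^sub>E I S) p"
      "\<And>U. U \<in> nbhds_of (box_topology I T) (\<lambda>i\<in>I. e i) \<Longrightarrow> U \<inter> Pi\<^sub>E I S \<in> p"
      by (simp_all add: near_star_def beta_def)
    have "B \<in> p" if "B \<in> ?N" for B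
      using 2[OF that] p(2) by blast
    then show "p \<in> star (Pi\<^sub>E I S) ?N"
      using p(1) by (auto simp: star_def)
  next
    fix p assume "p \<in> star (Pi\<^sub>E I S) ?N"
    then have p: "ultrafilter_on (Pi\<^sub>E I S) p" "?N \<subseteq> p"
      by (auto simp: star_def)
    have "U \<inter> Pi\<^sub>E I S \<in> p" if "U \<in> nbhds_of (box_topology I T) (\<lambda>i\<in>I. e i)" for U
      using 1[OF that] p(2) ultrafilter_onD(5)[OF p(1)] by (meson Int_lower2 subsetD)
    then show "p \<in> ?L"
      using p(1) by (auto simp: near_star_def beta_def)
  qed
qed

section \<open>The product semigroup with its base of boxes\<close>

locale near_product =
  fixes I :: "'i set" and S :: "'i \<Rightarrow> 'a set" and N :: "'i \<Rightarrow> 'a set set"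
    and f :: "'i \<Rightarrow> 'a \<Rightarrow> 'a \<Rightarrow> 'a"
  assumes factor: "i \<in> I \<Longrightarrow> near_semigroup (S i) (N i) (f i)"
begin

abbreviation "SI \<equiv> Pi\<^sub>E I S"
abbreviation "NI \<equiv> box_base I N"
abbreviation "fI \<equiv> prod_op I f"

lemma factor_base: "i \<in> I \<Longrightarrow> base_on (S i) (N i)"
  using factor near_semigroup.axioms(1) by blast

lemma factor_base_subset: "\<lbrakk>i \<in> I; U \<in> N i\<rbrakk> \<Longrightarrow> U \<subseteq> S i"
  using base_on.base_sub[OF factor_base] .

lemma box_subset: "(\<And>i. i \<in> I \<Longrightarrow> U i \<in> N i) \<Longrightarrow> Pi\<^sub>E I U \<subseteq> SI"
  by (intro PiE_mono factor_base_subset)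

lemma prod_op_mem: "\<lbrakk>x \<in> SI; y \<in> SI\<rbrakk> \<Longrightarrow> fI x y \<in> SI"
  using semigroup_onD(1)[OF near_semigroup.semigroup[OF factor]]
  by (auto simp: prod_op_def PiE_iff)

sublocale near_semigroup SI NI fI
proof
  have "\<forall>i\<in>I. \<exists>U. U \<in> N i"
    using base_on.base_ne[OF factor_base] by blast
  then show "NI \<noteq> {}"
    unfolding box_base_def by (auto dest: bchoice)
  fix B assume "B \<in> NI"
  then obtain U where U: "B = Pi\<^sub>E I U" "\<And>i. i \<in> I \<Longrightarrow> U i \<in> N i"
    by (auto simp: box_base_def)
  show "B \<subseteq> SI"
    unfolding U(1) using U(2) by (rule box_subset)
  show "B \<noteq> {}"
    unfolding U(1) using base_on.base_mem_ne[OF factor_base] U(2) by (simp add: PiE_eq_empty_iff)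
  show "\<exists>D\<in>NI. D \<subseteq> B \<inter> C" if "C \<in> NI" for C
  proof -
    obtain V where V: "C = Pi\<^sub>E I V" "\<And>i. i \<in> I \<Longrightarrow> V i \<in> N i"
      using \<open>C \<in> NI\<close> by (auto simp: box_base_def)
    have "\<forall>i\<in>I. \<exists>W. W \<in> N i \<and> W \<subseteq> U i \<inter> V i"
      using base_on.base_dir[OF factor_base] U(2) V(2) by blast
    then obtain W where W: "\<And>i. i \<in> I \<Longrightarrow> W i \<in> N i \<and> W i \<subseteq> U i \<inter> V i"
      by metis
    have "Pi\<^sub>E I W \<in> NI" "Pi\<^sub>E I W \<subseteq> B \<inter> C"
      unfolding U(1) V(1) PiE_Int using W by (auto simp: box_base_def intro!: PiE_mono)
    then show ?thesis
      by blast
  qed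
  \<comment> \<open>The sets required by \<open>base_op\<close> are chosen in each coordinate
    separately; the boxes they span belong to \<open>NI\<close>.\<close>
  have "\<forall>i\<in>I. \<exists>V. V \<in> N i \<and> (\<forall>x\<in>V. \<exists>W\<in>N i. \<forall>y\<in>W. f i x y \<in> U i)"
    using near_semigroup.base_op[OF factor] U(2) by blast
  then obtain V where V: "\<And>i. i \<in> I \<Longrightarrow> V i \<in> N i \<and> (\<forall>x\<in>V i. \<exists>W\<in>N i. \<forall>y\<in>W. f i x y \<in> U i)"
    by metis
  have "\<exists>D\<in>NI. \<forall>y\<in>D. fI x y \<in> B" if x: "x \<in> Pi\<^sub>E I V" for x
  proof -
    have "\<forall>i\<in>I. \<exists>W. W \<in> N i \<and> (\<forall>y\<in>W. f i (x i) y \<in> U i)"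
      using V x by blast
    then obtain W where W: "\<And>i. i \<in> I \<Longrightarrow> W i \<in> N i \<and> (\<forall>y\<in>W i. f i (x i) y \<in> U i)"
      by metis
    then have "Pi\<^sub>E I W \<in> NI" "\<forall>y\<in>Pi\<^sub>E I W. fI x y \<in> B"
      unfolding U(1) by (auto simp: box_base_def prod_op_def PiE_iff)
    then show ?thesis
      by blast
  qed
  moreover have "Pi\<^sub>E I V \<in> NI"
    using V by (auto simp: box_base_def)
  ultimately show "\<exists>C\<in>NI. \<forall>x\<in>C. \<exists>D\<in>NI. \<forall>y\<in>D. fI x y \<in> B"
    by blast
next
  have "fI (fI x y) z = fI x (fI y z)" if "x \<in> SI" "y \<in> SI" "z \<in> SI" for x y z
    unfolding prod_op_def using that semigroup_onD(2)[OF near_semigroup.semigroup[OF factor]]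
    by (intro restrict_ext) (auto simp: PiE_iff)
  then show "semigroup_on SI fI"
    using prod_op_mem by (auto simp: semigroup_on_def)
qed

section \<open>Coordinate projections of ultrafilters\<close>

definition proj :: "'i \<Rightarrow> ('i \<Rightarrow> 'a) set set \<Rightarrow> 'a set set" where
  "proj i p = {B. B \<subseteq> S i \<and> {x \<in> SI. x i \<in> B} \<in> p}"

text \<open>\<open>proj i p\<close> is the image ultrafilter of \<open>p\<close> under the
  coordinate map \<open>x \<mapsto> x i\<close>. It contains each \<open>U\<close> in
  \<open>N i\<close> because \<open>p\<close> contains a box with side \<open>U\<close> at
  \<open>i\<close>.\<close>

lemma proj_star:
  assumes p: "p \<in> star SI NI" and i: "i \<in> I"
  shows "proj i p \<in> star (S i) (N i)"
proof -
  note P = ultrafilter_onD[OF starD(1)[OF p]]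
  have "ultrafilter_on (S i) (proj i p)"
    unfolding ultrafilter_on_def
  proof (intro conjI ballI allI impI)
    have "{x \<in> SI. x i \<in> S i} = SI"
      using i by auto
    then show "S i \<in> proj i p"
      using P(1) by (simp add: proj_def)
    show "{} \<notin> proj i p"
      using P(2) by (simp add: proj_def)
    show "A \<inter> B \<in> proj i p" if "A \<in> proj i p" "B \<in> proj i p" for A B
    proof -
      have "{x \<in> SI. x i \<in> A \<inter> B} = {x \<in> SI. x i \<in> A} \<inter> {x \<in> SI. x i \<in> B}"
        by blast
      then show ?thesis
        using that P(4) by (auto simp: proj_def)
    qed
    show "B \<in> proj i p" if "A \<in> proj i p" "A \<subseteq> B \<and> B \<subseteq> S i" for A B
      using that P(5)[of "{x \<in> SI. x i \<in> A}" "{x \<in> SI. x i \<in> B}"] by (auto simp: proj_def)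
    show "A \<in> proj i p \<or> S i - A \<in> proj i p" if "A \<subseteq> S i" for A
    proof -
      have "{x \<in> SI. x i \<in> S i - A} = SI - {x \<in> SI. x i \<in> A}"
        using i by auto
      then show ?thesis
        using that P(6)[of "{x \<in> SI. x i \<in> A}"] by (auto simp: proj_def)
    qed
  qed (auto simp: proj_def)
  moreover have "U \<in> proj i p" if U: "U \<in> N i" for U
  proof -
    \<comment> \<open>Sides other than the one at \<open>i\<close> are arbitrary members of their
      bases.\<close>
    have "\<forall>j\<in>I. \<exists>W. W \<in> N j \<and> (j = i \<longrightarrow> W = U)"
      using base_on.base_ne[OF factor_base] U by blast
    then obtain W where W: "\<And>j. j \<in> I \<Longrightarrow> W j \<in> N j" "W i = U"
      using i by metis
    then have "Pi\<^sub>E I W \<in> p"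
      using starD(2)[OF p] by (auto simp: box_base_def)
    moreover have "Pi\<^sub>E I W \<subseteq> SI"
      using W(1) by (rule box_subset)
    then have "Pi\<^sub>E I W \<subseteq> {x \<in> SI. x i \<in> U}"
      using W(2) i by auto
    ultimately have "{x \<in> SI. x i \<in> U} \<in> p"
      by (rule P(5)) blast
    then show ?thesis
      using factor_base_subset[OF i U] by (simp add: proj_def)
  qed
  ultimately show ?thesis
    by (auto simp: star_def)
qed

text \<open>The operation acts coordinatewise, so the set of \<open>x\<close> that decides
  membership on the left restricts only \<open>x i\<close>, namely to the set that decides
  membership on the right.\<close>

lemma proj_beta_op:
  assumes i: "i \<in> I"
  shows "proj i (beta_op SI fI p q) = beta_op (S i) (f i) (proj i p) (proj i q)"
proof -
  have "{x \<in> SI. {y \<in> SI. fI x y \<in> {z \<in> SI. z i \<in> B}} \<in> q} =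
      {x \<in> SI. x i \<in> {a \<in> S i. {b \<in> S i. f i a b \<in> B} \<in> proj i q}}" for B
  proof -
    have "{y \<in> SI. fI x y \<in> {z \<in> SI. z i \<in> B}} = {y \<in> SI. y i \<in> {b \<in> S i. f i (x i) b \<in> B}}"
      if "x \<in> SI" for x
      using that i prod_op_mem by (auto simp: prod_op_def)
    then show ?thesis
      using i by (auto simp: proj_def)
  qed
  then show ?thesis
    unfolding proj_def[of i "beta_op SI fI p q"] beta_op_def[of "S i"]
    by (auto simp: beta_op_iff proj_def[of i p])
qed

text \<open>The boxes with sides in the \<open>p i\<close> form a filter base that refines
  \<open>NI\<close>. Boxes restricted in one coordinate only determine the projections. The last
  conclusion keeps all boxes, whereas the projections alone control only finitely many restricted
  sides.\<close>

lemma ex_star_boxes: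
  assumes p: "\<And>i. i \<in> I \<Longrightarrow> p i \<in> star (S i) (N i)"
  obtains u where "u \<in> star SI NI" "\<And>i. i \<in> I \<Longrightarrow> proj i u = p i"
    "\<And>B. (\<And>i. i \<in> I \<Longrightarrow> B i \<in> p i) \<Longrightarrow> Pi\<^sub>E I B \<in> u"
proof -
  have up: "ultrafilter_on (S i) (p i)" "N i \<subseteq> p i" if "i \<in> I" for i
    using p[OF that] by (auto simp: star_def)
  note P = ultrafilter_onD[OF up(1)]
  have "\<exists>u\<in>star SI NI. box_base I p \<subseteq> u"
  proof (rule ex_star)
    have "Pi\<^sub>E I B \<subseteq> SI" if "\<forall>i\<in>I. B i \<in> p i" for B
      using that P(3) by (intro PiE_mono) blast
    then show "box_base I p \<subseteq> Pow SI"
      unfolding box_base_def by blast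
    have "Pi\<^sub>E I B \<noteq> {}" if "\<forall>i\<in>I. B i \<in> p i" for B
      using that P(2) by (metis PiE_eq_empty_iff)
    then show "{} \<notin> box_base I p"
      unfolding box_base_def by blast
    show "\<exists>D\<in>box_base I p. D \<subseteq> B \<inter> C" if BC: "B \<in> box_base I p" "C \<in> box_base I p" for B C
    proof -
      obtain U V where "B = Pi\<^sub>E I U" "C = Pi\<^sub>E I V" "\<And>i. i \<in> I \<Longrightarrow> U i \<in> p i" "\<And>i. i \<in> I \<Longrightarrow> V i \<in> p i"
        using BC unfolding box_base_def by blast
      then have "B \<inter> C = Pi\<^sub>E I (\<lambda>i. U i \<inter> V i)" "\<forall>i\<in>I. U i \<inter> V i \<in> p i"
        using P(4) by (simp_all add: PiE_Int)
      then have "B \<inter> C \<in> box_base I p"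
        unfolding box_base_def by blast
      then show ?thesis
        by blast
    qed
    show "\<exists>B\<in>box_base I p. B \<subseteq> U" if "U \<in> NI" for U
    proof -
      obtain W where "U = Pi\<^sub>E I W" "\<forall>i\<in>I. W i \<in> N i"
        using \<open>U \<in> NI\<close> by (auto simp: box_base_def)
      then have "U \<in> box_base I p"
        using up(2) by (auto simp: box_base_def)
      then show ?thesis
        by blast
    qed
  qed
  then obtain u where u: "u \<in> star SI NI" "box_base I p \<subseteq> u"
    by blast
  have box: "Pi\<^sub>E I B \<in> u" if "\<And>i. i \<in> I \<Longrightarrow> B i \<in> p i" for B
    using u(2) that by (auto simp: box_base_def)
  have "p i = proj i u" if i: "i \<in> I" for i
  proof (rule base_on.star_eqI[OF factor_base[OF i] p[OF i] proj_star[OF u(1) i]], rule subsetI)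
    fix B assume B: "B \<in> p i"
    have "Pi\<^sub>E I (S(i := B)) \<in> u"
      using B P(1) by (intro box) auto
    moreover have "Pi\<^sub>E I (S(i := B)) \<subseteq> SI"
      using P(3)[OF i B] by (intro PiE_mono) auto
    then have "Pi\<^sub>E I (S(i := B)) \<subseteq> {x \<in> SI. x i \<in> B}"
      using i by (auto dest: PiE_mem)
    ultimately have "{x \<in> SI. x i \<in> B} \<in> u"
      by (rule ultrafilter_onD(5)[OF starD(1)[OF u(1)]]) blast
    then show "B \<in> proj i u"
      using P(3)[OF i B] by (simp add: proj_def)
  qed
  then show thesis
    using that[OF u(1)] box by auto
qed

corollary ex_star_proj:
  assumes "\<And>i. i \<in> I \<Longrightarrow> p i \<in> star (S i) (N i)"
  shows "\<exists>u\<in>star SI NI. \<forall>i\<in>I. proj i u = p i"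
  by (rule ex_star_boxes[OF assms]) auto

text \<open>Since \<open>proj i\<close> is a surjective homomorphism, the preimage of an ideal is an
  ideal, and \<open>p\<close> lies in every such preimage.\<close>

lemma proj_smallest_ideal:
  assumes p: "p \<in> smallest_ideal (star SI NI) (beta_op SI fI)" and i: "i \<in> I"
  shows "proj i p \<in> smallest_ideal (star (S i) (N i)) (beta_op (S i) (f i))"
proof -
  have "proj i p \<in> L" if L: "ideal_on (star (S i) (N i)) (beta_op (S i) (f i)) L" for L
  proof -
    obtain a where a: "a \<in> L" "a \<in> star (S i) (N i)"
      using L by (auto simp: ideal_on_def)
    \<comment> \<open>To lift \<open>a\<close> to the product, the other coordinates are filled with
      arbitrary points. The lift makes the preimage of \<open>L\<close> nonempty.\<close>
    have "\<forall>j\<in>I. \<exists>q. q \<in> star (S j) (N j) \<and> (j = i \<longrightarrow> q = a)"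
      using base_on.star_ne[OF factor_base] a(2) by blast
    then obtain q where q: "\<And>j. j \<in> I \<Longrightarrow> q j \<in> star (S j) (N j)" "q i = a"
      using i by metis
    obtain u where u: "u \<in> star SI NI" "proj i u = a"
      using ex_star_proj[of q] q i by auto
    have "ideal_on (star SI NI) (beta_op SI fI) {r \<in> star SI NI. proj i r \<in> L}"
      using L u a(1) beta_op_star proj_star[OF _ i] i
      by (auto simp: ideal_on_def proj_beta_op)
    then show ?thesis
      using p by (auto simp: smallest_ideal_def)
  qed
  then show ?thesis
    using p proj_star[OF _ i] by (simp add: smallest_ideal_def)
qed

section \<open>An idempotent of the smallest ideal that contains a given box\<close>

lemma ex_idempotent_box:
  assumes J: "finite J" "J \<subseteq> I"
    and p: "\<And>j. j \<in> J \<Longrightarrow> p j \<in> smallest_ideal (star (S j) (N j)) (beta_op (S j) (f j))"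
    and idem: "\<And>j. j \<in> J \<Longrightarrow> beta_op (S j) (f j) (p j) (p j) = p j"
    and A: "\<And>j. j \<in> J \<Longrightarrow> A j \<in> p j" "\<And>i. i \<in> I \<Longrightarrow> A i \<subseteq> S i"
    and thick: "\<And>i. i \<in> I - J \<Longrightarrow>
      \<exists>q\<in>star (S i) (N i). \<exists>U\<in>N i. \<forall>y\<in>U. {x \<in> S i. f i y x \<in> A i} \<in> q"
  shows "\<exists>r\<in>smallest_ideal (star SI NI) (beta_op SI fI). beta_op SI fI r r = r \<and> Pi\<^sub>E I A \<in> r"
proof -
  have pstar: "p j \<in> star (S j) (N j)" if "j \<in> J" for j
    using p[OF that] by (simp add: smallest_ideal_def)
  \<comment> \<open>This merges two choices: over \<open>J\<close> the idempotent \<open>p i\<close>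
    with any base set, elsewhere the ultrafilter and the base set coming from thickness.\<close>
  define good where "good i q U \<longleftrightarrow> q \<in> star (S i) (N i) \<and> U \<in> N i \<and>
    (if i \<in> J then q = p i else \<forall>y\<in>U. {x \<in> S i. f i y x \<in> A i} \<in> q)" for i q U
  have "\<exists>q U. good i q U" if i: "i \<in> I" for i
  proof (cases "i \<in> J")
    case True
    then show ?thesis
      using pstar[OF True] base_on.base_ne[OF factor_base[OF i]] by (auto simp: good_def)
  next
    case False
    then show ?thesis
      using thick[of i] i by (auto simp: good_def)
  qed
  then obtain q U where good: "\<And>i. i \<in> I \<Longrightarrow> good i (q i) (U i)"
    by metis
  have qU: "\<And>i. i \<in> I \<Longrightarrow> q i \<in> star (S i) (N i)" "\<And>i. i \<in> I \<Longrightarrow> U i \<in> N i"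
    "\<And>i. i \<in> J \<Longrightarrow> q i = p i"
    "\<And>i y. i \<in> I \<Longrightarrow> i \<notin> J \<Longrightarrow> y \<in> U i \<Longrightarrow> {x \<in> S i. f i y x \<in> A i} \<in> q i"
    using good J(2) by (auto simp: good_def)
  \<comment> \<open>The left ideal of \<open>w\<close> lies in the closure of \<open>D\<close>, and its projection to each \<open>j \<in> J\<close> is
    the minimal left ideal of \<open>p j\<close>. Hence a minimal left ideal \<open>L\<close> inside it contains some \<open>r\<close>
    with \<open>proj j r = p j\<close> for all \<open>j \<in> J\<close>, and these \<open>r\<close> form a compact subsemigroup.\<close>
  obtain w where w: "w \<in> star SI NI" "\<And>i. i \<in> I \<Longrightarrow> proj i w = q i"
    and boxes: "\<And>B. (\<And>i. i \<in> I \<Longrightarrow> B i \<in> q i) \<Longrightarrow> Pi\<^sub>E I B \<in> w"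
    using ex_star_boxes[OF qU(1)] by blast
  have US: "Pi\<^sub>E I U \<subseteq> SI"
    using qU(2) by (rule box_subset)
  define D where "D = {x \<in> SI. \<forall>i\<in>I - J. x i \<in> A i}"
  \<comment> \<open>For \<open>x\<close> in the box of the \<open>U i\<close>, each coordinate of
    \<open>fI x y\<close> outside \<open>J\<close> lies in \<open>A i\<close> whenever
    \<open>y i\<close> is in a suitable member of \<open>q i\<close>, and \<open>w\<close> contains
    the box of these members. The box of the \<open>U i\<close> belongs to \<open>a\<close>.\<close>
  have D: "D \<in> beta_op SI fI a w" if a: "a \<in> star SI NI" for a
  proof -
    have "{y \<in> SI. fI x y \<in> D} \<in> w" if x: "x \<in> Pi\<^sub>E I U" for x
    proof -
      \<comment> \<open>Sides over \<open>J\<close> stay unrestricted, as \<open>D\<close> imposes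
        nothing there.\<close>
      define B where "B i = (if i \<in> J then S i else {y \<in> S i. f i (x i) y \<in> A i})" for i
      have xS: "x \<in> SI"
        using x US by blast
      have "Pi\<^sub>E I B \<in> w"
      proof (rule boxes)
        fix i assume i: "i \<in> I"
        have "S i \<in> q i"
          using qU(1)[OF i] ultrafilter_onD(1) by (auto simp: star_def)
        then show "B i \<in> q i"
          using qU(4)[of i "x i"] i x by (auto simp: B_def)
      qed
      moreover have "Pi\<^sub>E I B \<subseteq> {y \<in> SI. fI x y \<in> D}"
      proof
        fix y assume y: "y \<in> Pi\<^sub>E I B"
        have "Pi\<^sub>E I B \<subseteq> SI"
          by (intro PiE_mono) (auto simp: B_def)
        then have yS: "y \<in> SI"
          using y by blast
        have "fI x y i \<in> A i" if "i \<in> I - J" for i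
          using y that by (auto simp: PiE_iff B_def prod_op_def)
        then show "y \<in> {y \<in> SI. fI x y \<in> D}"
          using yS prod_op_mem[OF xS yS] by (simp add: D_def)
      qed
      ultimately show ?thesis
        using ultrafilter_onD(5)[OF starD(1)[OF w(1)]] by blast
    qed
    then have "Pi\<^sub>E I U \<subseteq> {x \<in> SI. {y \<in> SI. fI x y \<in> D} \<in> w}"
      using US by blast
    moreover have "Pi\<^sub>E I U \<in> a"
      using starD(2)[OF a] qU(2) by (auto simp: box_base_def)
    ultimately have "{x \<in> SI. {y \<in> SI. fI x y \<in> D} \<in> w} \<in> a"
      using ultrafilter_onD(5)[OF starD(1)[OF a]] by blast
    then show ?thesis
      by (auto simp: beta_op_iff D_def)
  qed
  obtain L where L: "minimal_left L" "closedin (star_topology SI NI) L"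
    "L \<subseteq> (\<lambda>a. beta_op SI fI a w) ` star SI NI"
    using ex_minimal_left[of w] w(1) by auto
  then have Lstar: "L \<subseteq> star SI NI" and "L \<noteq> {}"
    by (auto simp: minimal_left_def)
  then obtain x where x: "x \<in> L" "x \<in> star SI NI"
    by blast
  obtain a where a: "a \<in> star SI NI" "x = beta_op SI fI a w"
    using x(1) L(3) by blast
  define C where "C = {r \<in> L. \<forall>j\<in>J. proj j r = p j}"
  \<comment> \<open>For \<open>i\<close> in \<open>J\<close>, \<open>proj i x\<close> is a left
    multiple of \<open>p i\<close>, and membership of \<open>p i\<close> in the smallest ideal
    supplies a left factor leading back to \<open>p i\<close>. Elsewhere the factor is arbitrary;
    all factors are then realised as the projections of a single \<open>u\<close>.\<close>
  have "\<exists>v. v \<in> star (S i) (N i) \<and> (i \<in> J \<longrightarrow> beta_op (S i) (f i) v (proj i x) = p i)"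
    if i: "i \<in> I" for i
  proof (cases "i \<in> J")
    case True
    interpret F: near_semigroup "S i" "N i" "f i"
      by (rule factor[OF i])
    have "proj i x = beta_op (S i) (f i) (proj i a) (p i)"
      using a(2) i w(2)[OF i] qU(3)[OF True] by (simp add: proj_beta_op)
    then show ?thesis
      using F.smallest_ideal_left_solvable[of "p i" "proj i a"] p[OF True] proj_star[OF a(1) i]
      by (metis F.topspace_star_topology)
  qed (use base_on.star_ne[OF factor_base[OF i]] in auto)
  then obtain v where *: "\<And>i. i \<in> I \<Longrightarrow> v i \<in> star (S i) (N i) \<and>
      (i \<in> J \<longrightarrow> beta_op (S i) (f i) (v i) (proj i x) = p i)"
    by metis
  then have v: "\<And>i. i \<in> I \<Longrightarrow> v i \<in> star (S i) (N i)"
    "\<And>i. i \<in> J \<Longrightarrow> beta_op (S i) (f i) (v i) (proj i x) = p i"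
    using J(2) by auto
  obtain u where u: "u \<in> star SI NI" "\<forall>i\<in>I. proj i u = v i"
    using ex_star_proj[OF v(1)] by blast
  have "proj j (beta_op SI fI u x) = p j" if "j \<in> J" for j
    using that J(2) u(2) v(2) by (auto simp: proj_beta_op subset_iff)
  then have "beta_op SI fI u x \<in> C"
    using minimal_left_mem[OF L(1) _ x(1)] u(1) by (simp add: C_def)
  then have "C \<noteq> {}"
    by blast
  moreover have "closedin (star_topology SI NI) C"
  proof -
    \<comment> \<open>By maximality of ultrafilters \<open>proj j r = p j\<close> amounts to
      \<open>p j \<subseteq> proj j r\<close>, so the closed sets \<open>E j B\<close> cut the fibre
      out of \<open>L\<close>.\<close>
    define E where "E j B = {r \<in> star SI NI. {x \<in> SI. x j \<in> B} \<in> r}" for j B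
    have "proj j r = p j \<longleftrightarrow> (\<forall>B\<in>p j. r \<in> E j B)" if r: "r \<in> L" and j: "j \<in> J" for r j
    proof -
      have "j \<in> I" "r \<in> star SI NI"
        using r j Lstar J(2) by auto
      then have "p j \<subseteq> proj j r \<Longrightarrow> p j = proj j r"
        using base_on.star_eqI[OF factor_base] pstar[OF j] proj_star by blast
      moreover have "p j \<subseteq> proj j r \<longleftrightarrow> (\<forall>B\<in>p j. r \<in> E j B)"
        using ultrafilter_onD(3)[of "S j" "p j"] pstar[OF j] \<open>r \<in> star SI NI\<close>
        by (auto simp: proj_def E_def star_def subset_iff)
      ultimately show ?thesis
        by auto
    qed
    then have "C = \<Inter>(insert L ((\<lambda>(j, B). E j B) ` (SIGMA j:J. p j)))"
      by (auto simp: C_def)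
    moreover have "closedin (star_topology SI NI) (\<Inter>(insert L ((\<lambda>(j, B). E j B) ` (SIGMA j:J. p j))))"
      using L(2) closedin_star_basic by (intro closedin_Inter) (auto simp: E_def)
    ultimately show ?thesis
      by simp
  qed
  moreover have "beta_op SI fI r s \<in> C" if rs: "r \<in> C" "s \<in> C" for r s
  proof -
    \<comment> \<open>Idempotence of \<open>p j\<close> keeps the fibre closed under the
      operation.\<close>
    have "proj j (beta_op SI fI r s) = p j" if "j \<in> J" for j
      using rs that J(2) idem by (auto simp: C_def proj_beta_op subset_iff)
    moreover have "beta_op SI fI r s \<in> L"
      using rs Lstar minimal_left_mem[OF L(1)] by (auto simp: C_def)
    ultimately show ?thesis
      by (simp add: C_def)
  qed
  ultimately obtain r where r: "r \<in> C" "beta_op SI fI r r = r"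
    using ellis[of C] by blast
  then have rL: "r \<in> L"
    by (simp add: C_def)
  then have ur: "ultrafilter_on SI r"
    using Lstar starD(1) by blast
  have "{x \<in> SI. x j \<in> A j} \<in> r" if j: "j \<in> J" for j
  proof -
    have "A j \<in> proj j r"
      using r(1) A(1)[OF j] j by (simp add: C_def)
    then show ?thesis
      by (simp add: proj_def)
  qed
  \<comment> \<open>Finiteness of \<open>J\<close> allows these conditions to be intersected inside
    \<open>r\<close>; all other coordinates are handled at once by \<open>D\<close>.\<close>
  then have "{x \<in> SI. \<forall>j\<in>J. x j \<in> A j} \<in> r"
    by (rule ultrafilter_on_finite_Inter[OF ur J(1)])
  moreover have "D \<in> r"
    using rL L(3) D by blast
  ultimately have "{x \<in> SI. \<forall>j\<in>J. x j \<in> A j} \<inter> D \<in> r"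
    using ultrafilter_onD(4)[OF ur] by blast
  moreover have "{x \<in> SI. \<forall>j\<in>J. x j \<in> A j} \<inter> D \<subseteq> Pi\<^sub>E I A"
    unfolding D_def PiE_def Pi_def by blast
  moreover have "Pi\<^sub>E I A \<subseteq> SI"
    using A(2) by (intro PiE_mono)
  ultimately have "Pi\<^sub>E I A \<in> r"
    by (rule ultrafilter_onD(5)[OF ur])
  moreover have "r \<in> smallest_ideal (star SI NI) (beta_op SI fI)"
    using minimal_left_subset_smallest_ideal[OF L(1)] rL by auto
  ultimately show ?thesis
    using r(2) by blast
qed

end

section \<open>Central sets in the factors and in the product\<close>

theorem theorem2p25:
  fixes I :: "'i set"
    and T :: "'i \<Rightarrow> 'a topology"
    and f :: "'i \<Rightarrow> 'a \<Rightarrow> 'a \<Rightarrow> 'a"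
    and e :: "'i \<Rightarrow> 'a"
    and S A :: "'i \<Rightarrow> 'a set"
  assumes "\<And>i. i \<in> I \<Longrightarrow> semitopological_semigroup (T i) (f i)"
    and "\<And>i. i \<in> I \<Longrightarrow> near_subsemigroup (T i) (f i) (e i) (S i)"
    and "\<And>i. i \<in> I \<Longrightarrow> A i \<subseteq> S i"
    and "finite {i\<in>I. \<not> thick_near (T i) (f i) (e i) (S i) (A i)}"
  shows "central_near (box_topology I T) (prod_op I f) (\<lambda>i\<in>I. e i) (Pi\<^sub>E I S) (Pi\<^sub>E I A)
         \<longleftrightarrow> (\<forall>i\<in>I. central_near (T i) (f i) (e i) (S i) (A i))"
proof -
  define N where "N i = nbhd_trace (T i) (e i) (S i)" for i
  interpret near_product I S N f
    unfolding N_def using assms(1,2) by (intro near_product.intro near_semigroup_nbhd_trace)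
  \<comment> \<open>Both kinds of centrality are restated over \<open>star\<close>, so that the
    results on filter bases apply.\<close>
  have central: "central_near (T i) (f i) (e i) (S i) (A i) \<longleftrightarrow>
      (\<exists>p\<in>smallest_ideal (star (S i) (N i)) (beta_op (S i) (f i)). beta_op (S i) (f i) p p = p \<and> A i \<in> p)"
    for i
    by (simp add: central_near_def near_star_eq_star N_def)
  have central_prod: "central_near (box_topology I T) (prod_op I f) (\<lambda>i\<in>I. e i) (Pi\<^sub>E I S) (Pi\<^sub>E I A) \<longleftrightarrow>
      (\<exists>p\<in>smallest_ideal (star SI NI) (beta_op SI fI). beta_op SI fI p p = p \<and> Pi\<^sub>E I A \<in> p)"
    by (simp add: central_near_def near_star_box_topology flip: N_def)
  show ?thesis
    unfolding central central_prod
  proof (intro iffI ballI)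
    fix i assume i: "i \<in> I"
    assume "\<exists>p\<in>smallest_ideal (star SI NI) (beta_op SI fI). beta_op SI fI p p = p \<and> Pi\<^sub>E I A \<in> p"
    then obtain p where p: "p \<in> smallest_ideal (star SI NI) (beta_op SI fI)"
      "beta_op SI fI p p = p" "Pi\<^sub>E I A \<in> p"
      by blast
    have "ultrafilter_on SI p"
      using p(1) starD(1) by (simp add: smallest_ideal_def)
    moreover have "Pi\<^sub>E I A \<subseteq> SI"
      using assms(3) by (intro PiE_mono)
    then have "Pi\<^sub>E I A \<subseteq> {x \<in> SI. x i \<in> A i}"
      using i by auto
    ultimately have "{x \<in> SI. x i \<in> A i} \<in> p"
      using ultrafilter_onD(5) p(3) by blast
    then have "A i \<in> proj i p"
      using assms(3)[OF i] by (simp add: proj_def)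
    moreover have "beta_op (S i) (f i) (proj i p) (proj i p) = proj i p"
      using proj_beta_op[OF i, of p p] p(2) by simp
    ultimately show "\<exists>p\<in>smallest_ideal (star (S i) (N i)) (beta_op (S i) (f i)).
        beta_op (S i) (f i) p p = p \<and> A i \<in> p"
      using proj_smallest_ideal[OF p(1) i] by blast
  next
    define J where "J = {i\<in>I. \<not> thick_near (T i) (f i) (e i) (S i) (A i)}"
    assume "\<forall>i\<in>I. \<exists>p\<in>smallest_ideal (star (S i) (N i)) (beta_op (S i) (f i)).
        beta_op (S i) (f i) p p = p \<and> A i \<in> p"
    then obtain p where p: "\<And>i. i \<in> I \<Longrightarrow> p i \<in> smallest_ideal (star (S i) (N i)) (beta_op (S i) (f i))"
      "\<And>i. i \<in> I \<Longrightarrow> beta_op (S i) (f i) (p i) (p i) = p i" "\<And>i. i \<in> I \<Longrightarrow> A i \<in> p i"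
      by metis
    have sub: "J \<subseteq> I"
      by (auto simp: J_def)
    show "\<exists>p\<in>smallest_ideal (star SI NI) (beta_op SI fI). beta_op SI fI p p = p \<and> Pi\<^sub>E I A \<in> p"
    proof (rule ex_idempotent_box[of J p A])
      show "finite J"
        using assms(4) by (simp add: J_def)
      show "\<exists>q\<in>star (S i) (N i). \<exists>U\<in>N i. \<forall>y\<in>U. {x \<in> S i. f i y x \<in> A i} \<in> q" if "i \<in> I - J" for i
        using that assms(1,2) thick_near_ex_star[of "T i" "f i" "e i" "S i" "A i"]
        by (auto simp: J_def N_def)
    qed (use p sub assms(3) in auto)
  qed
qed

end
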